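(* Let $m,n>-1/2$, $\alpha_1,\alpha_2>0$, let $X\sim\mathrm{VG}(m,\alpha_1,0,0)$ and $Y\sim\mathrm{VG}(n,\alpha_2,0,0)$ be independent and $Z=XY$. Then for all $z\in\mathbb{R}$, \[ F_Z(z)=\frac12+\frac{\alpha_1\alpha_2z}{8\pi\Gamma(m+1/2)\Gamma(n+1/2)}G^{4,1}_{1,5}\bigg(\frac{\alpha_1^2\alpha_2^2}{16}z^2\,\bigg|\,{\frac12\atop 0,0,m,n,-\frac12}\bigg) =\frac12+\frac{\mathrm{sgn}(z)}{2\pi\Gamma(m+1/2)\Gamma(n+1/2)}G^{4,1}_{1,5}\bigg(\frac{\alpha_1^2\alpha_2^2}{16}z^2\,\bigg|\,{1\atop \frac12,\frac12,m+\frac12,n+\frac12,0}\bigg). \]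
   Context: For $\mu>-1/2$, $\alpha>0$ and $0\le|\beta|<\alpha$, $\mathrm{VG}(\mu,\alpha,\beta,0)$ denotes the variance-gamma distribution on $\mathbb{R}$ with probability density function $f(x)=\frac{(\alpha^2-\beta^2)^{\mu+1/2}}{\sqrt{\pi}(2\alpha)^{\mu}\Gamma(\mu+1/2)}e^{\beta x}|x|^{\mu}K_{\mu}(\alpha|x|)$, where $K_\nu$ is the modified Bessel function of the second kind. $F_Z(z)=\mathbb{P}(Z\le z)$; $\mathrm{sgn}$ is the sign function with $\mathrm{sgn}(0)=0$. The Meijer $G$-function is defined by $G^{k,l}_{p,q}\big(x\,\big|\,{a_1,\dots,a_p\atop b_1,\dots,b_q}\big)=\frac{1}{2\pi\mathrm{i}}\int_L\frac{\prod_{j=1}^k\Gamma(b_j-s)\prod_{j=1}^l\Gamma(1-a_j+s)}{\prod_{j=l+1}^p\Gamma(a_j-s)\prod_{j=k+1}^q\Gamma(1-b_j+s)}x^s\,\mathrm{d}s$, where the path $L$ separates the poles of the $\Gamma(b_j-s)$ from those of the $\Gamma(1-a_j+s)$, and empty products are $1$. *)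

theory Defs
  imports "HOL-Probability.Probability"
begin

text \<open>Modified Bessel function of the second kind, for x > 0, via the standard
integral representation K_nu(x) = int_0^infty exp(-x cosh t) cosh(nu t) dt.\<close>
definition besselK :: "real \<Rightarrow> real \<Rightarrow> real" where
  "besselK nu x = (LBINT t:{0..}. exp (- x * cosh t) * cosh (nu * t))"

definition vg_pdf :: "real \<Rightarrow> real \<Rightarrow> real \<Rightarrow> real \<Rightarrow> real" where
  "vg_pdf mu alpha beta x =
     (alpha\<^sup>2 - beta\<^sup>2) powr (mu + 1/2) / (sqrt pi * (2 * alpha) powr mu * Gamma (mu + 1/2))
     * exp (beta * x) * \<bar>x\<bar> powr mu * besselK mu (alpha * \<bar>x\<bar>)"

text \<open>Integrand of the Mellin--Barnes integral defining the Meijer G-function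
  G^{k,l}_{p,q}(x | as ; bs), with p = length as, q = length bs.\<close>
definition meijerG_kernel :: "nat \<Rightarrow> nat \<Rightarrow> real list \<Rightarrow> real list \<Rightarrow> complex \<Rightarrow> complex" where
  "meijerG_kernel k l as bs s =
     (\<Prod>j<k. Gamma (complex_of_real (bs!j) - s)) * (\<Prod>j<l. Gamma (1 - complex_of_real (as!j) + s))
     / ((\<Prod>j\<in>{l..<length as}. Gamma (complex_of_real (as!j) - s))
        * (\<Prod>j\<in>{k..<length bs}. Gamma (1 - complex_of_real (bs!j) + s)))"

text \<open>A vertical line Re s = c separates the poles of the Gamma(b_j - s), j<k
  (at s = b_j + n) from those of the Gamma(1 - a_j + s), j<l (at s = a_j - 1 - n).\<close>
definition meijerG_separates :: "nat \<Rightarrow> nat \<Rightarrow> real list \<Rightarrow> real list \<Rightarrow> real \<Rightarrow> bool" where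
  "meijerG_separates k l as bs c \<longleftrightarrow>
     (\<forall>j<k. c < bs!j) \<and> (\<forall>j<l. as!j - 1 < c)"

text \<open>Meijer G-function for real parameters and real argument x \<ge> 0, with the
  contour L taken to be a separating vertical line c + i R (traversed upward):
  (1/(2 pi i)) int_L phi(s) x^s ds = (1/(2 pi)) int phi(c+it) x^(c+it) dt.\<close>
definition meijerG :: "nat \<Rightarrow> nat \<Rightarrow> real list \<Rightarrow> real list \<Rightarrow> real \<Rightarrow> complex" where
  "meijerG k l as bs x =
     (let c = (SOME c. meijerG_separates k l as bs c) in
      complex_of_real (1 / (2 * pi)) *
        (LINT t|lborel. meijerG_kernel k l as bs (Complex c t) * (complex_of_real x) powr (Complex c t)))"

end

theory Submission
  imports Defs
begin

text \<open>
  Since \<open>\<alpha>\<^sup>2 X\<^sup>2 / 4\<close> has the law of a product of two independent gamma variables, of shapes \<open>\<mu> + 1/2\<close> and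
  \<open>1/2\<close> for \<open>X \<sim> VG(\<mu>, \<alpha>, 0, 0)\<close>, the variable \<open>\<alpha>\<^sub>1\<^sup>2 \<alpha>\<^sub>2\<^sup>2 Z\<^sup>2 / 16\<close> has the law of a product of four gamma variables.
  In the logarithmic coordinate, multiplying by a gamma variable is a convolution, and on the side of the
  Mellin--Barnes integrand it is multiplication by a factor \<open>\<Gamma>(a - s)\<close>, by an absolutely convergent
  Fubini argument. The bare distribution function has integrand \<open>1/s\<close>, which is not integrable;
  therefore the induction starts from \<open>2 min(1, exp(y/2))\<close>, whose integrand is \<open>1/(s (1/2 - s))\<close>:
  multiplication by \<open>\<Gamma>(3/2 - s)\<close> gives \<open>\<Gamma>(1/2 - s)/s\<close>, the same as one gamma factor applied to
  the bare distribution function. The resulting formula holds on every admissible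
  vertical line, so no contour has to be moved to compare the two \<open>G\<close>-functions.
\<close>


section \<open>Logarithmic coordinates\<close>

text \<open>Tonelli for a majorant with separated variables. It supplies the Fubini hypothesis both
  in the Fourier inversion and in the convolution step for Mellin integrals.\<close>

lemma integrable_pair_bound:
  fixes F :: "real \<times> real \<Rightarrow> 'b::{banach, second_countable_topology}" and f g :: "real \<Rightarrow> real"
  assumes f: "integrable lborel f" and g: "integrable lborel g"
    and [measurable]: "F \<in> borel_measurable (lborel \<Otimes>\<^sub>M lborel)"
    and bound: "\<And>x y. norm (F (x, y)) \<le> f x * g y"
  shows "integrable (lborel \<Otimes>\<^sub>M lborel) F"
proof -
  have "integrable (lborel \<Otimes>\<^sub>M lborel) (\<lambda>(x, y). f x * g y)"
  proof (rule lborel_pair.Fubini_integrable)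
    show "(\<lambda>(x, y). f x * g y) \<in> borel_measurable (lborel \<Otimes>\<^sub>M lborel)"
      using f g by measurable
    show "integrable lborel (\<lambda>x. LBINT y. norm (case (x, y) of (x, y) \<Rightarrow> f x * g y))"
      using f by (simp add: abs_mult integrable_abs)
    show "AE x in lborel. integrable lborel (\<lambda>y. case (x, y) of (x, y) \<Rightarrow> f x * g y)"
      using g by simp
  qed
  then show ?thesis
    by (rule Bochner_Integration.integrable_bound) (use bound in \<open>auto intro!: AE_I2 order_trans[OF bound]\<close>)
qed

text \<open>Substitution on compact intervals, then monotone convergence as they exhaust the line.
  The endpoint \<open>Suc n\<close> keeps the interval nondegenerate at
  \<open>n = 0\<close>.\<close>

lemma nn_integral_exp_substitution:
  fixes f :: "real \<Rightarrow> ennreal"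
  assumes [measurable]: "f \<in> borel_measurable borel"
  shows "(\<integral>\<^sup>+x. f x * indicator {0<..} x \<partial>lborel) = (\<integral>\<^sup>+t. f (exp t) * ennreal (exp t) \<partial>lborel)"
proof -
  have sub: "(\<integral>\<^sup>+x. f x * indicator {exp (- real (Suc n))..exp (real (Suc n))} x \<partial>lborel)
      = (\<integral>\<^sup>+t. f (exp t) * ennreal (exp t) * indicator {- real (Suc n)..real (Suc n)} t \<partial>lborel)" for n
    by (rule nn_integral_substitution_aux) (auto intro!: derivative_eq_intros continuous_intros)
  have *: "(SUP n. indicator {exp (- real (Suc n))..exp (real (Suc n))} x) = (indicator {0<..} x :: ennreal)" for x :: real
  proof (cases "x > 0")
    case True
    obtain n where n: "\<bar>ln x\<bar> \<le> real n" using real_arch_simple by blast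
    have "exp (- real (Suc n)) \<le> exp (ln x)" "exp (ln x) \<le> exp (real (Suc n))"
      using n by simp_all
    then have "exp (- real (Suc n)) \<le> x" "x \<le> exp (real (Suc n))"
      using True by simp_all
    then have "(SUP n. indicator {exp (- real (Suc n))..exp (real (Suc n))} x) \<ge> (1::ennreal)"
      by (intro SUP_upper2[of n]) auto
    moreover have "(SUP n. indicator {exp (- real (Suc n))..exp (real (Suc n))} x) \<le> (1::ennreal)"
      by (intro SUP_least) (auto split: split_indicator)
    ultimately show ?thesis using True by (simp add: antisym)
  next
    case False
    then have "indicator {exp (- real (Suc n))..exp (real (Suc n))} x = (0::ennreal)" for n
      by (metis atLeastAtMost_iff exp_gt_zero indicator_simps(2) less_le_trans)
    then show ?thesis using False by simp
  qed
  have **: "(SUP n. indicator {- real (Suc n)..real (Suc n)} t) = (1 :: ennreal)" for t :: real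
  proof -
    obtain n where n: "\<bar>t\<bar> \<le> real n" using real_arch_simple by blast
    then have "(SUP n. indicator {- real (Suc n)..real (Suc n)} t) \<ge> (1::ennreal)"
      by (intro SUP_upper2[of n]) (auto split: split_indicator)
    moreover have "(SUP n. indicator {- real (Suc n)..real (Suc n)} t) \<le> (1::ennreal)"
      by (intro SUP_least) (auto split: split_indicator)
    ultimately show ?thesis by (simp add: antisym)
  qed
  have "(\<integral>\<^sup>+x. f x * indicator {0<..} x \<partial>lborel)
      = (\<integral>\<^sup>+x. (SUP n. f x * indicator {exp (- real (Suc n))..exp (real (Suc n))} x) \<partial>lborel)"
    by (simp only: * SUP_mult_left_ennreal[symmetric])
  also have "\<dots> = (SUP n. \<integral>\<^sup>+x. f x * indicator {exp (- real (Suc n))..exp (real (Suc n))} x \<partial>lborel)"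
  proof (rule nn_integral_monotone_convergence_SUP)
    show "incseq (\<lambda>n x. f x * indicator {exp (- real (Suc n))..exp (real (Suc n))} x)"
    proof (intro incseq_SucI le_funI mult_left_mono)
      fix n and x :: real
      have "{exp (- real (Suc n))..exp (real (Suc n))} \<subseteq> {exp (- real (Suc (Suc n)))..exp (real (Suc (Suc n)))}"
        by (intro atLeastatMost_subset_iff[THEN iffD2] disjI2) simp
      then show "indicator {exp (- real (Suc n))..exp (real (Suc n))} x
          \<le> (indicator {exp (- real (Suc (Suc n)))..exp (real (Suc (Suc n)))} x :: ennreal)"
        by (rule indicator_leI[rule_format, OF subsetD])
    qed simp
  qed measurable
  also have "\<dots> = (SUP n. \<integral>\<^sup>+t. f (exp t) * ennreal (exp t) * indicator {- real (Suc n)..real (Suc n)} t \<partial>lborel)"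
    by (simp only: sub)
  also have "\<dots> = (\<integral>\<^sup>+t. (SUP n. f (exp t) * ennreal (exp t) * indicator {- real (Suc n)..real (Suc n)} t) \<partial>lborel)"
  proof (rule nn_integral_monotone_convergence_SUP[symmetric])
    show "incseq (\<lambda>n t. f (exp t) * ennreal (exp t) * indicator {- real (Suc n)..real (Suc n)} t)"
      by (intro incseq_SucI le_funI mult_left_mono) (auto split: split_indicator)
  qed measurable
  also have "\<dots> = (\<integral>\<^sup>+t. f (exp t) * ennreal (exp t) \<partial>lborel)"
    by (simp only: ** SUP_mult_left_ennreal[symmetric] mult_1_right)
  finally show ?thesis .
qed

text \<open>As an identity of measures, the substitution passes from nonnegative to vector-valued
  integrands.\<close>

lemma distr_exp_lborel:
  "distr (density lborel (\<lambda>t. ennreal (exp t))) borel exp = density lborel (indicator {0::real<..})"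
proof (rule measure_eqI)
  fix A :: "real set"
  assume "A \<in> sets (distr (density lborel (\<lambda>t. ennreal (exp t))) borel exp)"
  then have [measurable]: "A \<in> sets borel" by simp
  have "emeasure (distr (density lborel (\<lambda>t. ennreal (exp t))) borel exp) A
      = (\<integral>\<^sup>+t. indicator A (exp t) * ennreal (exp t) \<partial>lborel)"
    by (subst emeasure_distr, simp, simp, subst emeasure_density)
       (auto intro!: nn_integral_cong measurable_sets_borel[of exp borel, simplified] simp: mult.commute split: split_indicator)
  also have "\<dots> = (\<integral>\<^sup>+x. indicator A x * indicator {0<..} x \<partial>lborel)"
    by (rule nn_integral_exp_substitution[symmetric]) simp
  also have "\<dots> = emeasure (density lborel (indicator {0::real<..})) A"
    by (subst emeasure_density) (auto intro!: nn_integral_cong simp: mult.commute)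
  finally show "emeasure (distr (density lborel (\<lambda>t. ennreal (exp t))) borel exp) A
    = emeasure (density lborel (indicator {0::real<..})) A" .
qed simp

lemma integral_exp_substitution:
  fixes f :: "real \<Rightarrow> 'b::{banach, second_countable_topology}"
  assumes [measurable]: "f \<in> borel_measurable borel"
  shows "integrable lborel (\<lambda>t. exp t *\<^sub>R f (exp t)) \<longleftrightarrow> integrable lborel (\<lambda>x. indicator {0<..} x *\<^sub>R f x)"
    and "(LBINT t. exp t *\<^sub>R f (exp t)) = (LBINT x. indicator {0<..} x *\<^sub>R f x)"
proof -
  \<comment> \<open>The density rules take a real function coerced by \<open>ennreal\<close>, while
    \<open>distr_exp_lborel\<close> speaks of the \<open>ennreal\<close>-valued indicator.\<close>
  have d: "density lborel (\<lambda>x. ennreal (indicator {0<..} x)) = density lborel (indicator {0::real<..})"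
    by (intro density_cong) (auto split: split_indicator)
  have "integrable lborel (\<lambda>t. exp t *\<^sub>R f (exp t))
      \<longleftrightarrow> integrable (density lborel (\<lambda>t. ennreal (exp t))) (\<lambda>t. f (exp t))"
    by (subst integrable_density) auto
  also have "\<dots> \<longleftrightarrow> integrable (distr (density lborel (\<lambda>t. ennreal (exp t))) borel exp) f"
    by (subst integrable_distr_eq) auto
  also have "\<dots> \<longleftrightarrow> integrable (density lborel (\<lambda>x. ennreal (indicator {0<..} x))) f"
    by (simp only: distr_exp_lborel d)
  also have "\<dots> \<longleftrightarrow> integrable lborel (\<lambda>x. indicator {0<..} x *\<^sub>R f x)"
    by (subst integrable_density) auto
  finally show "integrable lborel (\<lambda>t. exp t *\<^sub>R f (exp t))
    \<longleftrightarrow> integrable lborel (\<lambda>x. indicator {0<..} x *\<^sub>R f x)" .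
  have "(LBINT t. exp t *\<^sub>R f (exp t))
      = integral\<^sup>L (density lborel (\<lambda>t. ennreal (exp t))) (\<lambda>t. f (exp t))"
    by (subst integral_density) auto
  also have "\<dots> = integral\<^sup>L (distr (density lborel (\<lambda>t. ennreal (exp t))) borel exp) f"
    by (subst integral_distr) auto
  also have "\<dots> = integral\<^sup>L (density lborel (\<lambda>x. ennreal (indicator {0<..} x))) f"
    by (simp only: distr_exp_lborel d)
  also have "\<dots> = (LBINT x. indicator {0<..} x *\<^sub>R f x)"
    by (subst integral_density) auto
  finally show "(LBINT t. exp t *\<^sub>R f (exp t)) = (LBINT x. indicator {0<..} x *\<^sub>R f x)" .
qed

text \<open>Euler's integral under \<open>v = exp p\<close>: the measure
  \<open>v powr (z - 1) * exp (- v) dv\<close> becomes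
  \<open>exp (z * p - exp p) dp\<close>.\<close>

lemma
  fixes z :: complex
  assumes z: "Re z > 0"
  shows integrable_Gamma_log: "integrable lborel (\<lambda>p::real. exp (z * p - complex_of_real (exp p)))"
    and integral_Gamma_log: "(LBINT p::real. exp (z * p - complex_of_real (exp p))) = Gamma z"
proof -
  define f where "f x = exp ((z - 1) * ln x - x)" for x :: real
  have [measurable]: "f \<in> borel_measurable borel" unfolding f_def by measurable
  have eq: "exp t *\<^sub>R f (exp t) = exp (z * t - complex_of_real (exp t))" for t :: real
    by (simp add: f_def scaleR_conv_of_real exp_of_real[symmetric] exp_add[symmetric] algebra_simps)
  have f_eq: "complex_of_real t powr (z - 1) / of_real (exp t) = f t" if "t \<in> {0<..}" for t
    using that by (simp add: f_def powr_def Ln_of_real exp_diff exp_of_real)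
  have "f absolutely_integrable_on {0<..}"
    using absolutely_integrable_Gamma_integral'[OF z] f_eq
    by (auto intro: set_integrable_cong[THEN iffD1, rotated -1])
  \<comment> \<open>Euler's integral is available as a gauge integral; it reaches
    \<open>lborel\<close> through the completed measure \<open>lebesgue\<close>.\<close>
  then have leb: "set_integrable lebesgue {0<..} f" .
  then have "integrable lebesgue (\<lambda>x. indicator {0<..} x *\<^sub>R f x)"
    by (simp add: set_integrable_def)
  then have int: "integrable lborel (\<lambda>x. indicator {0<..} x *\<^sub>R f x)"
    by (subst (asm) integrable_completion) auto
  show "integrable lborel (\<lambda>p::real. exp (z * p - complex_of_real (exp p)))"
    using int integral_exp_substitution(1)[of f] by (simp add: eq)
  have "(LBINT x. indicator {0<..} x *\<^sub>R f x) = (LINT x:{0<..}|lebesgue. f x)"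
    unfolding set_lebesgue_integral_def by (rule integral_completion[symmetric]) simp
  also have "\<dots> = integral {0<..} f"
    by (rule set_lebesgue_integral_eq_integral(2)[OF leb])
  also have "\<dots> = Gamma z"
    using has_integral_eq[OF f_eq Gamma_integral_complex'[OF z]] by (simp add: integral_unique)
  finally show "(LBINT p::real. exp (z * p - complex_of_real (exp p))) = Gamma z"
    using integral_exp_substitution(2)[of f] by (simp add: eq)
qed

section \<open>Fourier inversion\<close>

text \<open>After scaling by \<open>\<sigma>\<close> this is the characteristic function of the
  standard normal law. Writing the result as a normal density prepares the approximate identity used
  for inversion.\<close>

lemma gaussian_fourier:
  fixes \<sigma> v :: real
  assumes "\<sigma> > 0"
  shows "(LBINT t. iexp (t * v) * complex_of_real (exp (- (t / \<sigma>)\<^sup>2 / 2)))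
    = complex_of_real (2 * pi * \<sigma> * std_normal_density (\<sigma> * v))"
proof -
  have "(LBINT t. iexp (t * v) * complex_of_real (exp (- (t / \<sigma>)\<^sup>2 / 2)))
      = \<bar>\<sigma>\<bar> *\<^sub>R (LBINT t. iexp ((0 + \<sigma> * t) * v) * complex_of_real (exp (- ((0 + \<sigma> * t) / \<sigma>)\<^sup>2 / 2)))"
    using assms by (intro lborel_integral_real_affine) simp
  also have "(LBINT t. iexp ((0 + \<sigma> * t) * v) * complex_of_real (exp (- ((0 + \<sigma> * t) / \<sigma>)\<^sup>2 / 2)))
      = (LBINT t. complex_of_real (sqrt (2 * pi)) * (std_normal_density t *\<^sub>R iexp ((\<sigma> * v) * t)))"
    using assms by (intro Bochner_Integration.integral_cong)
      (auto simp: std_normal_density_def scaleR_conv_of_real mult_ac)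
  also have "\<dots> = complex_of_real (sqrt (2 * pi)) * char std_normal_distribution (\<sigma> * v)"
    unfolding integral_mult_right_zero char_def by (subst integral_density) auto
  also have "\<dots> = complex_of_real (sqrt (2 * pi) * exp (- ((\<sigma> * v)\<^sup>2) / 2))"
    by (simp add: char_std_normal_distribution)
  also have "\<dots> = complex_of_real (2 * pi * std_normal_density (\<sigma> * v))"
  proof -
    define r where "r = sqrt (2 * pi)"
    have r: "2 * pi = r * r" "r \<noteq> 0" by (simp_all add: r_def)
    have "sqrt (2 * pi) * exp (- ((\<sigma> * v)\<^sup>2) / 2) = 2 * pi * std_normal_density (\<sigma> * v)"
      unfolding std_normal_density_def r_def[symmetric] unfolding r(1) using r(2) by simp
    then show ?thesis by (simp only:)
  qed
  finally show ?thesis using assms by (simp add: scaleR_conv_of_real mult_ac)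
qed

lemma integrable_gaussian:
  assumes "\<sigma> > (0::real)"
  shows "integrable lborel (\<lambda>t. exp (- (t / \<sigma>)\<^sup>2 / 2))"
proof -
  have "integrable lborel (\<lambda>t. sqrt (2 * pi) * std_normal_density t)" by simp
  then have "integrable lborel (\<lambda>t::real. exp (- t\<^sup>2 / 2))" by (simp add: std_normal_density_def)
  from lborel_integrable_real_affine[OF this, of "1 / \<sigma>" 0] show ?thesis
    using assms by simp
qed

text \<open>Regularise by the Gaussian factor which turns the inverse transform into a
  convolution of \<open>h\<close> with an approximate identity.\<close>
lemma fourier_inversion:
  fixes h :: "real \<Rightarrow> complex"
  assumes h: "integrable lborel h" and bounded: "\<And>y. norm (h y) \<le> B" and cont: "isCont h u"
    and H: "integrable lborel (\<lambda>t. LBINT y. h y * iexp (- (t * y)))"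
  shows "(LBINT t. (LBINT y. h y * iexp (- (t * y))) * iexp (t * u)) = 2 * pi * h u"
proof -
  define H where "H t = (LBINT y. h y * iexp (- (t * y)))" for t
  have [measurable]: "h \<in> borel_measurable borel" using h by auto
  have Hint: "integrable lborel H" using H by (simp add: H_def[abs_def])
  then have [measurable]: "H \<in> borel_measurable borel" by auto
  define A where "A n = (LBINT t. H t * iexp (t * u) * complex_of_real (exp (- (t / real (Suc n))\<^sup>2 / 2)))" for n
  have lim: "A \<longlonglongrightarrow> (LBINT t. H t * iexp (t * u))"
    unfolding A_def
  proof (rule integral_dominated_convergence[where w="\<lambda>t. norm (H t)"])
    show "AE t in lborel. (\<lambda>n. H t * iexp (t * u) * complex_of_real (exp (- (t / real (Suc n))\<^sup>2 / 2)))
        \<longlonglongrightarrow> H t * iexp (t * u)"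
    proof (rule AE_I2)
      fix t
      have "(\<lambda>n. t / real (Suc n)) \<longlonglongrightarrow> 0"
        by (rule LIMSEQ_Suc[OF lim_const_over_n])
      then have "(\<lambda>n. H t * iexp (t * u) * complex_of_real (exp (- (t / real (Suc n))\<^sup>2 / 2)))
          \<longlonglongrightarrow> H t * iexp (t * u) * complex_of_real (exp (- 0\<^sup>2 / 2))"
        by (intro tendsto_intros) auto
      then show "(\<lambda>n. H t * iexp (t * u) * complex_of_real (exp (- (t / real (Suc n))\<^sup>2 / 2)))
          \<longlonglongrightarrow> H t * iexp (t * u)" by simp
    qed
    show "AE t in lborel. norm (H t * iexp (t * u) * complex_of_real (exp (- (t / real (Suc n))\<^sup>2 / 2)))
        \<le> norm (H t)" for n
      by (intro AE_I2) (auto simp: norm_mult intro!: mult_left_le)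
  qed (auto intro!: integrable_norm Hint)
  \<comment> \<open>Fubini and the substitution of \<open>u - y / \<sigma>\<close> for
    \<open>y\<close> make \<open>A n\<close> a normal average of \<open>h\<close> around
    \<open>u\<close> at scale \<open>1 / Suc n\<close>. Continuity at \<open>u\<close> and the bound
    \<open>B\<close> then give a second limit of \<open>A\<close>.\<close>
  have A: "A n = 2 * pi * (LBINT y. std_normal_density y *\<^sub>R h (u - y / real (Suc n)))" for n
  proof -
    define \<sigma> where "\<sigma> = real (Suc n)"
    have \<sigma>: "\<sigma> > 0" by (simp add: \<sigma>_def)
    define g where "g t = exp (- (t / \<sigma>)\<^sup>2 / 2)" for t :: real
    have g: "integrable lborel g" unfolding g_def by (rule integrable_gaussian[OF \<sigma>])
    have [measurable]: "g \<in> borel_measurable borel" using g by auto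
    have int: "integrable (lborel \<Otimes>\<^sub>M lborel) (\<lambda>(y, t). h y * iexp (t * (u - y)) * complex_of_real (g t))"
      by (rule integrable_pair_bound[OF integrable_norm[OF h] g])
         (auto simp: norm_mult g_def)
    have "A n = (LBINT t. LBINT y. h y * iexp (t * (u - y)) * complex_of_real (g t))"
      unfolding A_def
    proof (rule Bochner_Integration.integral_cong[OF refl])
      fix t
      have "(LBINT y. h y * iexp (t * (u - y)) * complex_of_real (g t))
          = (LBINT y. (iexp (t * u) * complex_of_real (g t)) * (h y * iexp (- (t * y))))"
        by (intro Bochner_Integration.integral_cong) (auto simp: exp_add[symmetric] algebra_simps exp_diff exp_minus field_simps)
      also have "\<dots> = (iexp (t * u) * complex_of_real (g t)) * H t"
        unfolding H_def by (rule integral_mult_right_zero)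
      finally show "H t * iexp (t * u) * complex_of_real (exp (- (t / real (Suc n))\<^sup>2 / 2))
          = (LBINT y. h y * iexp (t * (u - y)) * complex_of_real (g t))"
        by (simp add: g_def \<sigma>_def mult_ac)
    qed
    also have "\<dots> = (LBINT y. LBINT t. h y * iexp (t * (u - y)) * complex_of_real (g t))"
      by (rule lborel_pair.Fubini_integral[OF int])
    also have "\<dots> = (LBINT y. h y * complex_of_real (2 * pi * \<sigma> * std_normal_density (\<sigma> * (u - y))))"
    proof (rule Bochner_Integration.integral_cong[OF refl])
      fix y
      have "(LBINT t. h y * iexp (t * (u - y)) * complex_of_real (g t))
          = h y * (LBINT t. iexp (t * (u - y)) * complex_of_real (g t))"
        by (subst integral_mult_right_zero[symmetric]) (simp add: mult_ac)
      then show "(LBINT t. h y * iexp (t * (u - y)) * complex_of_real (g t))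
          = h y * complex_of_real (2 * pi * \<sigma> * std_normal_density (\<sigma> * (u - y)))"
        unfolding g_def by (simp only: gaussian_fourier[OF \<sigma>])
    qed
    also have "\<dots> = \<bar>- (1 / \<sigma>)\<bar> *\<^sub>R (LBINT y. h (u + - (1 / \<sigma>) * y)
        * complex_of_real (2 * pi * \<sigma> * std_normal_density (\<sigma> * (u - (u + - (1 / \<sigma>) * y)))))"
      using \<sigma> by (intro lborel_integral_real_affine) simp
    also have "\<dots> = (LBINT y. (1 / \<sigma>) *\<^sub>R (h (u + - (1 / \<sigma>) * y)
        * complex_of_real (2 * pi * \<sigma> * std_normal_density (\<sigma> * (u - (u + - (1 / \<sigma>) * y))))))"
      using \<sigma> by simp
    also have "\<dots> = (LBINT y. (2 * pi) * (std_normal_density y *\<^sub>R h (u - y / \<sigma>)))"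
      using \<sigma> by (intro Bochner_Integration.integral_cong) (auto simp: scaleR_conv_of_real)
    also have "\<dots> = 2 * pi * (LBINT y. std_normal_density y *\<^sub>R h (u - y / \<sigma>))"
      by (rule integral_mult_right_zero)
    finally show ?thesis by (simp add: \<sigma>_def)
  qed
  have "(\<lambda>n. LBINT y. std_normal_density y *\<^sub>R h (u - y / real (Suc n)))
      \<longlonglongrightarrow> (LBINT y. std_normal_density y *\<^sub>R h u)"
  proof (rule integral_dominated_convergence[where w="\<lambda>y. std_normal_density y * B"])
    show "AE y in lborel. (\<lambda>n. std_normal_density y *\<^sub>R h (u - y / real (Suc n)))
        \<longlonglongrightarrow> std_normal_density y *\<^sub>R h u"
    proof (intro AE_I2 tendsto_intros)
      fix y
      have "(\<lambda>n. y / real (Suc n)) \<longlonglongrightarrow> 0"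
        by (rule LIMSEQ_Suc[OF lim_const_over_n])
      then have "(\<lambda>n. u - y / real (Suc n)) \<longlonglongrightarrow> u - 0"
        by (intro tendsto_intros)
      then show "(\<lambda>n. h (u - y / real (Suc n))) \<longlonglongrightarrow> h u"
        using isCont_tendsto_compose[OF cont] by simp
    qed
  qed (auto intro!: mult_left_mono bounded)
  then have "(\<lambda>n. 2 * pi * (LBINT y. std_normal_density y *\<^sub>R h (u - y / real (Suc n))))
      \<longlonglongrightarrow> 2 * pi * (LBINT y. std_normal_density y *\<^sub>R h u)"
    by (intro tendsto_intros)
  then have "A \<longlonglongrightarrow> 2 * pi * h u" by (simp add: A[abs_def] del: of_nat_Suc)
  from LIMSEQ_unique[OF lim this] show ?thesis by (simp only: H_def)
qed

text \<open>The Laplace transform of the constant 1. Two such pieces, one of them reflected, make up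
  the Fourier transform in \<open>mellin_rep_min\<close>.\<close>

lemma
  fixes s :: complex
  assumes s: "Re s > 0"
  shows integrable_exp_halfline: "integrable lborel (\<lambda>u. indicator {0..} u *\<^sub>R exp (- (s * complex_of_real u)))"
    and integral_exp_halfline: "(LBINT u. indicator {0..} u *\<^sub>R exp (- (s * complex_of_real u))) = 1 / s"
proof -
  have s0: "s \<noteq> 0" using s by auto
  define f where "f u = exp (- (s * complex_of_real u))" for u :: real
  have [measurable]: "f \<in> borel_measurable borel" unfolding f_def by measurable
  have norm_f: "norm (f u) = exp (- (Re s * u))" for u by (simp add: f_def)
  have exp0: "((\<lambda>u. exp (- (Re s * u))) \<longlongrightarrow> 0) at_top"
  proof (rule filterlim_compose[OF exp_at_bot])
    show "LIM u at_top. - (Re s * u) :> at_bot"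
      unfolding filterlim_uminus_at_bot minus_minus
      by (rule filterlim_tendsto_pos_mult_at_top[OF tendsto_const s filterlim_ident])
  qed
  have int: "integrable lborel (\<lambda>u. indicator {0..} u *\<^sub>R f u)"
  proof (rule integrableI_bounded)
    have "(\<integral>\<^sup>+u. ennreal (norm (indicator {0..} u *\<^sub>R f u)) \<partial>lborel)
        = (\<integral>\<^sup>+u. ennreal (exp (- (Re s * u))) * indicator {0..} u \<partial>lborel)"
      by (intro nn_integral_cong) (auto simp: norm_f split: split_indicator)
    also have "\<dots> = ennreal (0 - (- exp (- (Re s * 0)) / Re s))"
    proof (rule nn_integral_FTC_atLeast)
      show "((\<lambda>u. - exp (- (Re s * u)) / Re s) \<longlongrightarrow> 0) at_top"
        using tendsto_divide[OF tendsto_minus[OF exp0] tendsto_const, of "Re s"] s by simp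
    qed (use s in \<open>auto intro!: derivative_eq_intros\<close>)
    finally show "(\<integral>\<^sup>+u. ennreal (norm (indicator {0..} u *\<^sub>R f u)) \<partial>lborel) < \<infinity>" by simp
  qed measurable
  then show "integrable lborel (\<lambda>u. indicator {0..} u *\<^sub>R exp (- (s * complex_of_real u)))"
    by (simp add: f_def)
  \<comment> \<open>The value is found on \<open>{0..n}\<close> from the antiderivative
    \<open>- f u / s\<close>; dominated convergence passes to the half line.\<close>
  have "(\<lambda>n. LBINT u. indicator {0..real n} u *\<^sub>R f u) \<longlonglongrightarrow> (LBINT u. indicator {0..} u *\<^sub>R f u)"
  proof (rule integral_dominated_convergence[where w="\<lambda>u. norm (indicator {0..} u *\<^sub>R f u)"])
    show "AE u in lborel. (\<lambda>n. indicator {0..real n} u *\<^sub>R f u) \<longlonglongrightarrow> indicator {0..} u *\<^sub>R f u"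
    proof (intro AE_I2 tendsto_eventually)
      fix u :: real
      obtain N where "u \<le> real N" using real_arch_simple by blast
      then show "\<forall>\<^sub>F n in sequentially. indicator {0..real n} u *\<^sub>R f u = indicator {0..} u *\<^sub>R f u"
        by (intro eventually_sequentiallyI[of N]) (auto split: split_indicator)
    qed
  qed (use integrable_norm[OF int] in \<open>auto split: split_indicator\<close>)
  moreover have "(LBINT u. indicator {0..real n} u *\<^sub>R f u) = (1 - f (real n)) / s" for n
  proof -
    have "(LBINT u. indicator {0..real n} u *\<^sub>R f u) = - f (real n) / s - (- f 0 / s)"
    proof (rule integral_FTC_atLeastAtMost)
      fix u :: real
      have "((\<lambda>z. - exp (- (s * z)) / s) has_field_derivative - (exp (- (s * of_real u)) * - s) / s) (at (of_real u))"
        by (intro DERIV_cdivide DERIV_minus DERIV_fun_exp) (auto intro!: derivative_eq_intros)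
      then show "((\<lambda>u. - f u / s) has_vector_derivative f u) (at u within {0..real n})"
        unfolding f_def using s0 by (auto dest: has_vector_derivative_real_field)
    qed (auto simp: f_def intro!: continuous_intros)
    then show ?thesis by (simp add: f_def diff_divide_distrib)
  qed
  moreover have "(\<lambda>n. f (real n)) \<longlonglongrightarrow> 0"
    by (rule tendsto_norm_zero_cancel, unfold norm_f) (rule filterlim_compose[OF exp0 filterlim_real_sequentially])
  then have "(\<lambda>n. (1 - f (real n)) / s) \<longlonglongrightarrow> (1 - 0) / s"
    by (intro tendsto_divide tendsto_diff tendsto_const s0)
  ultimately show "(LBINT u. indicator {0..} u *\<^sub>R exp (- (s * complex_of_real u))) = 1 / s"
    by (simp add: f_def LIMSEQ_unique)
qed

section \<open>Mellin representations\<close>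

text \<open>The unnormalised gamma density of shape \<open>a\<close> in the coordinate
  \<open>p = ln v\<close>; the Jacobian \<open>exp p\<close> raises the exponent from
  \<open>a - 1\<close> to \<open>a\<close>.\<close>

definition gamma_weight :: "real \<Rightarrow> real \<Rightarrow> real" where
  "gamma_weight a p = exp (a * p - exp p)"

lemma gamma_weight_measurable [measurable]: "gamma_weight a \<in> borel_measurable borel"
  unfolding gamma_weight_def by measurable

lemma gamma_weight_nonneg [simp]: "gamma_weight a p \<ge> 0"
  by (simp add: gamma_weight_def)

text \<open>\<open>gamma_conv a g (ln x) = \<integral>\<^sup>+ v \<in> {0<..}. v powr (a - 1) * exp (- v) * g (ln (x / v))\<close>\<close>
definition gamma_conv :: "real \<Rightarrow> (real \<Rightarrow> ennreal) \<Rightarrow> real \<Rightarrow> ennreal" where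
  "gamma_conv a g y = (\<integral>\<^sup>+p. ennreal (gamma_weight a p) * g (y - p) \<partial>lborel)"

lemma gamma_conv_measurable [measurable]:
  assumes [measurable]: "g \<in> borel_measurable borel"
  shows "gamma_conv a g \<in> borel_measurable borel"
  unfolding gamma_conv_def by measurable

text \<open>With \<open>s = c + i t\<close> and \<open>x = exp y\<close>: the function \<open>f (ln x)\<close> is the inverse Mellin transform
  \<open>1/(2 \<pi> i) \<integral> \<Phi>(s) x\<^sup>s ds\<close> along \<open>Re s = c\<close>.\<close>
definition mellin_rep :: "real \<Rightarrow> (real \<Rightarrow> complex) \<Rightarrow> (real \<Rightarrow> real) \<Rightarrow> bool" where
  "mellin_rep c \<Phi> f \<longleftrightarrow> integrable lborel \<Phi> \<and> f \<in> borel_measurable borel \<and>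
     (\<forall>y. 0 \<le> f y \<and> (LBINT t. \<Phi> t * exp (Complex c t * y)) = complex_of_real (2 * pi * f y))"

lemma integrable_gamma_weight:
  assumes "a > 0"
  shows "integrable lborel (gamma_weight a)"
proof -
  have "integrable lborel (\<lambda>p. norm (exp (complex_of_real a * p - complex_of_real (exp p))))"
    by (intro integrable_norm integrable_Gamma_log) (use assms in simp)
  then show ?thesis by (simp add: gamma_weight_def[abs_def])
qed

text \<open>Integrating \<open>gamma_weight a p * exp (- s * p)\<close> over \<open>p\<close> gives
  \<open>Gamma (a - s)\<close>, convergent because \<open>Re s = c < a\<close>. Hence convolving the
  function multiplies the integrand by this factor, on the same line.\<close>

lemma mellin_rep_gamma_conv:
  assumes rep: "mellin_rep c \<Phi> f" and ac: "c < a"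
  obtains g where "mellin_rep c (\<lambda>t. \<Phi> t * Gamma (a - Complex c t)) g"
    and "\<And>y. gamma_conv a (\<lambda>y. ennreal (f y)) y = ennreal (g y)"
proof -
  from rep have \<Phi>: "integrable lborel \<Phi>" and [measurable]: "f \<in> borel_measurable borel"
    and f0: "f y \<ge> 0" and f: "(LBINT t. \<Phi> t * exp (Complex c t * y)) = complex_of_real (2 * pi * f y)" for y
    by (auto simp: mellin_rep_def)
  have [measurable]: "\<Phi> \<in> borel_measurable borel" using \<Phi> by auto
  define F where "F y p t = complex_of_real (gamma_weight a p) * (\<Phi> t * exp (Complex c t * (y - p)))" for y p t :: real
  have Complex_meas [measurable]: "Complex c \<in> borel_measurable borel"
    unfolding Complex_eq by measurable
  \<comment> \<open>On the line \<open>Re s = c\<close> the modulus of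
    \<open>exp (s * (y - p))\<close> is \<open>exp (c * y) * exp (- c * p)\<close>, which lowers the
    shape from \<open>a\<close> to \<open>a - c\<close> and separates \<open>p\<close> from
    \<open>t\<close>.\<close>
  have int: "integrable (lborel \<Otimes>\<^sub>M lborel) (case_prod (F y))" for y
  proof (rule integrable_pair_bound)
    show "integrable lborel (gamma_weight (a - c))" using ac by (intro integrable_gamma_weight) simp
    show "integrable lborel (\<lambda>t. norm (exp (c * y) * \<Phi> t))" using \<Phi> by simp
    show "norm (case (p, t) of (p, t) \<Rightarrow> F y p t) \<le> gamma_weight (a - c) p * norm (exp (c * y) * \<Phi> t)" for p t
      by (simp add: F_def norm_mult gamma_weight_def exp_diff[symmetric] exp_add[symmetric] algebra_simps)
  qed (unfold F_def, measurable)
  have Ft: "(LBINT t. F y p t) = complex_of_real (2 * pi * (gamma_weight a p * f (y - p)))" for y p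
    unfolding F_def integral_mult_right_zero using f[of "y - p"] by simp
  have Fp: "(LBINT p. F y p t) = \<Phi> t * Gamma (a - Complex c t) * exp (Complex c t * y)" for y t
  proof -
    have "(LBINT p. F y p t)
        = (LBINT p. (\<Phi> t * exp (Complex c t * y)) * exp ((a - Complex c t) * p - complex_of_real (exp p)))"
    proof (intro Bochner_Integration.integral_cong refl)
      fix p
      have "complex_of_real (gamma_weight a p) * exp (Complex c t * (y - p))
          = exp (Complex c t * y) * exp ((a - Complex c t) * p - complex_of_real (exp p))"
        unfolding gamma_weight_def exp_of_real[symmetric] exp_add[symmetric]
          by (simp add: algebra_simps exp_of_real)
      then show "F y p t = (\<Phi> t * exp (Complex c t * y)) * exp ((a - Complex c t) * p - complex_of_real (exp p))"
        by (simp add: F_def mult_ac)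
    qed
    also have "\<dots> = (\<Phi> t * exp (Complex c t * y)) * Gamma (a - Complex c t)"
      unfolding integral_mult_right_zero using ac by (subst integral_Gamma_log) auto
    finally show ?thesis by (simp add: mult_ac)
  qed
  define g where "g y = (LBINT p. gamma_weight a p * f (y - p))" for y
  \<comment> \<open>Fubini also yields integrability of the real convolution, which later identifies
    its Bochner integral with the nonnegative integral in \<open>gamma_conv\<close>.\<close>
  have "integrable lborel (\<lambda>p. Re (LBINT t. F y p t))" for y
    by (intro integrable_Re lborel_pair.integrable_fst[OF int])
  then have gint: "integrable lborel (\<lambda>p. gamma_weight a p * f (y - p))" for y
    unfolding Ft by simp
  have "(LBINT t. \<Phi> t * Gamma (a - Complex c t) * exp (Complex c t * y)) = complex_of_real (2 * pi * g y)" for y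
  proof -
    have "(LBINT t. \<Phi> t * Gamma (a - Complex c t) * exp (Complex c t * y)) = (LBINT t. LBINT p. F y p t)"
      by (simp only: Fp)
    also have "\<dots> = (LBINT p. LBINT t. F y p t)"
      by (rule lborel_pair.Fubini_integral[OF int])
    also have "\<dots> = complex_of_real (2 * pi * g y)"
      unfolding Ft g_def by (simp del: of_real_mult add: integral_complex_of_real)
    finally show ?thesis .
  qed
  \<comment> \<open>At \<open>y = 0\<close> the exponential factor in \<open>Fp\<close> is 1, so
    Fubini gives the integrability of the new integrand itself.\<close>
  moreover have "integrable lborel (\<lambda>t. \<Phi> t * Gamma (a - Complex c t))"
    using lborel_pair.integrable_snd[OF int[of 0]] by (simp add: Fp)
  moreover have "g \<in> borel_measurable borel" unfolding g_def by measurable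
  moreover have "g y \<ge> 0" for y
    unfolding g_def using f0 by (intro Bochner_Integration.integral_nonneg) simp
  ultimately have "mellin_rep c (\<lambda>t. \<Phi> t * Gamma (a - Complex c t)) g"
    by (simp add: mellin_rep_def)
  moreover have "gamma_conv a (\<lambda>y. ennreal (f y)) y = ennreal (g y)" for y
    unfolding gamma_conv_def g_def
    by (subst nn_integral_eq_integral[OF gint, symmetric]) (auto simp: f0 ennreal_mult)
  ultimately show ?thesis by (rule that)
qed

text \<open>Multiplication by \<open>exp (- c * y)\<close> turns the function into a two-sided
  exponential with rates \<open>c\<close> and \<open>1/2 - c\<close>. Its Fourier transform is
  \<open>2 * (1 / s + 1 / (1/2 - s)) = 1 / (s * (1/2 - s))\<close>, which decays quadratically, so
  inversion applies at every point.\<close>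

lemma mellin_rep_min:
  assumes c: "0 < c" "c < 1/2"
  shows "mellin_rep c (\<lambda>t. 1 / (Complex c t * (1/2 - Complex c t))) (\<lambda>y. 2 * min 1 (exp (y / 2)))"
proof -
  define d where "d = 1/2 - c"
  have d: "0 < d" using c by (simp add: d_def)
  define \<Phi> where "\<Phi> t = 1 / (Complex c t * (1/2 - Complex c t))" for t
  define h where "h y = complex_of_real (2 * min (exp (- c * y)) (exp (d * y)))" for y
  have H: "has_bochner_integral lborel (\<lambda>y. h y * iexp (- (t * y))) (\<Phi> t)" for t
  proof -
    let ?s = "Complex c t"
    have s: "Re ?s > 0" "Re (1/2 - ?s) > 0" using c by auto
    have h1: "has_bochner_integral lborel (\<lambda>y. indicator {0..} y *\<^sub>R exp (- (?s * complex_of_real y))) (1 / ?s)"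
      using integrable_exp_halfline[OF s(1)] integral_exp_halfline[OF s(1)]
      by (simp add: has_bochner_integral_iff)
    have "has_bochner_integral lborel (\<lambda>y. indicator {0..} y *\<^sub>R exp (- ((1/2 - ?s) * complex_of_real y))) (1 / (1/2 - ?s))"
      using integrable_exp_halfline[OF s(2)] integral_exp_halfline[OF s(2)]
      by (simp only: has_bochner_integral_iff)
    then have h2: "has_bochner_integral lborel (\<lambda>y. indicator {0..} (- y) *\<^sub>R exp (- ((1/2 - ?s) * complex_of_real (- y)))) (1 / (1/2 - ?s))"
      by (subst (asm) lborel_has_bochner_integral_real_affine_iff[of "-1" _ _ 0]) auto
    have "has_bochner_integral lborel (\<lambda>y. 2 * (indicator {0..} y *\<^sub>R exp (- (?s * complex_of_real y))
        + indicator {0..} (- y) *\<^sub>R exp (- ((1/2 - ?s) * complex_of_real (- y))))) (2 * (1 / ?s + 1 / (1/2 - ?s)))"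
      by (intro has_bochner_integral_mult_right has_bochner_integral_add h1 h2)
    also have "2 * (1 / ?s + 1 / (1/2 - ?s)) = \<Phi> t"
    proof -
      have "?s \<noteq> 0" "1/2 - ?s \<noteq> 0" using s by (metis zero_complex.sel(1) less_irrefl)+
      then show ?thesis unfolding \<Phi>_def by (simp add: divide_simps)
    qed
    finally have *: "has_bochner_integral lborel (\<lambda>y. 2 * (indicator {0..} y *\<^sub>R exp (- (?s * complex_of_real y))
        + indicator {0..} (- y) *\<^sub>R exp (- ((1/2 - ?s) * complex_of_real (- y))))) (\<Phi> t)" .
    \<comment> \<open>Only almost everywhere: at \<open>y = 0\<close> both indicators are 1 and the
      left side is 4, while \<open>h 0 = 2\<close>.\<close>
    have "AE y in lborel. 2 * (indicator {0..} y *\<^sub>R exp (- (?s * complex_of_real y))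
        + indicator {0..} (- y) *\<^sub>R exp (- ((1/2 - ?s) * complex_of_real (- y)))) = h y * iexp (- (t * y))"
      using AE_lborel_singleton[of 0]
    proof (eventually_elim)
      fix y :: real assume "y \<noteq> 0"
      then consider "y > 0" | "y < 0" by linarith
      then show "2 * (indicator {0..} y *\<^sub>R exp (- (?s * complex_of_real y))
        + indicator {0..} (- y) *\<^sub>R exp (- ((1/2 - ?s) * complex_of_real (- y)))) = h y * iexp (- (t * y))"
      proof cases
        case 1
        then have "- c * y \<le> d * y" using c d by (smt (verit) mult_minus_left mult_pos_pos)
        then have "h y = 2 * exp (complex_of_real (- c * y))"
          by (simp add: h_def min_def exp_of_real[symmetric])
        then show ?thesis using 1
          by (simp add: exp_add[symmetric] Complex_eq algebra_simps)
      next
        case 2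
        then have "d * y \<le> - c * y" using c d by (smt (verit) mult_minus_left mult_pos_neg)
        then have "h y = 2 * exp (complex_of_real (d * y))"
          by (simp add: h_def min_def exp_of_real[symmetric])
        then show ?thesis using 2
          by (simp add: d_def exp_add[symmetric] Complex_eq algebra_simps)
      qed
    qed
    moreover have "h \<in> borel_measurable borel" unfolding h_def by measurable
    ultimately show ?thesis
      by (intro has_bochner_integral_cong_AE[THEN iffD1, OF _ _ _ *]) auto
  qed
  have hint: "integrable lborel h"
    using H[of 0] by (auto simp: has_bochner_integral_iff)
  have \<Phi>int: "integrable lborel \<Phi>"
  proof (rule Bochner_Integration.integrable_bound)
    \<comment> \<open>\<open>e\<close> bounds the real parts of both factors from below, and
      \<open>e \<le> 1\<close> lets it be pulled in front of \<open>t\<close> as well. Each factor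
      thus has modulus at least \<open>e * sqrt (1 + t\<^sup>2)\<close>.\<close>
    define e where "e = min c d"
    have e: "0 < e" "e \<le> c" "e \<le> d" "e \<le> 1" using c d by (auto simp: e_def)
    show "integrable lborel (\<lambda>t. 1 / e\<^sup>2 * inverse (1 + t\<^sup>2))"
      using integrable_inverse_1_plus_square by (simp add: set_integrable_def)
    show "\<Phi> \<in> borel_measurable lborel"
      unfolding \<Phi>_def Complex_eq by measurable
    show "AE t in lborel. norm (\<Phi> t) \<le> norm (1 / e\<^sup>2 * inverse (1 + t\<^sup>2))"
    proof (rule AE_I2)
      fix t :: real
      have low: "e * sqrt (1 + t\<^sup>2) \<le> sqrt (r\<^sup>2 + t\<^sup>2)" if "e \<le> r" for r
      proof (rule real_le_rsqrt)
        have "e\<^sup>2 \<le> r\<^sup>2" using e that by (intro power_mono) auto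
        moreover have "e\<^sup>2 * t\<^sup>2 \<le> 1 * t\<^sup>2" using e by (intro mult_right_mono) (auto simp: power_le_one)
        ultimately show "(e * sqrt (1 + t\<^sup>2))\<^sup>2 \<le> r\<^sup>2 + t\<^sup>2"
          by (simp add: power_mult_distrib algebra_simps)
      qed
      have "(e * sqrt (1 + t\<^sup>2)) * (e * sqrt (1 + t\<^sup>2)) \<le> norm (Complex c t) * norm (1/2 - Complex c t)"
      proof (intro mult_mono)
        show "e * sqrt (1 + t\<^sup>2) \<le> norm (Complex c t)" using low[OF e(2)] by (simp add: complex_norm)
        have "norm (1/2 - Complex c t) = sqrt (d\<^sup>2 + t\<^sup>2)" by (simp add: cmod_def d_def)
        then show "e * sqrt (1 + t\<^sup>2) \<le> norm (1/2 - Complex c t)" using low[OF e(3)] by simp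
      qed (use e in auto)
      then have *: "e\<^sup>2 * (1 + t\<^sup>2) \<le> norm (Complex c t) * norm (1/2 - Complex c t)"
        by (simp add: power2_eq_square mult_ac)
      have "norm (\<Phi> t) = 1 / (norm (Complex c t) * norm (1/2 - Complex c t))"
        by (simp add: \<Phi>_def norm_divide norm_mult)
      also have "\<dots> \<le> 1 / (e\<^sup>2 * (1 + t\<^sup>2))"
        using * e by (intro divide_left_mono) (auto intro!: mult_pos_pos add_pos_nonneg order_less_le_trans[OF _ *])
      finally show "norm (\<Phi> t) \<le> norm (1 / e\<^sup>2 * inverse (1 + t\<^sup>2))"
        by (simp add: divide_simps abs_mult)
    qed
  qed
  have Heq: "(LBINT y. h y * iexp (- (t * y))) = \<Phi> t" for t
    using H by (rule has_bochner_integral_integral_eq)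
  have bnd: "norm (h y) \<le> 2" for y
  proof -
    have "min (exp (- c * y)) (exp (d * y)) \<le> 1"
    proof (cases "y \<ge> 0")
      case True
      then have "exp (- c * y) \<le> 1" using c by simp
      then show ?thesis by linarith
    next
      case False
      then have "exp (d * y) \<le> 1" using d by (simp add: mult_le_0_iff)
      then show ?thesis by linarith
    qed
    then show ?thesis by (simp add: h_def)
  qed
  have cont: "isCont h y" for y unfolding h_def by (intro continuous_intros)
  have inv: "(LBINT t. \<Phi> t * iexp (t * y)) = 2 * pi * h y" for y
    using fourier_inversion[OF hint bnd cont, of y] \<Phi>int unfolding Heq by blast
  have "(LBINT t. \<Phi> t * exp (Complex c t * y)) = complex_of_real (2 * pi * (2 * min 1 (exp (y / 2))))" for y
  proof -
    have "(LBINT t. \<Phi> t * exp (Complex c t * y)) = (LBINT t. exp (complex_of_real (c * y)) * (\<Phi> t * iexp (t * y)))"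
      by (intro Bochner_Integration.integral_cong refl) (simp add: Complex_eq exp_add[symmetric] algebra_simps)
    also have "\<dots> = exp (complex_of_real (c * y)) * (2 * pi * h y)"
      unfolding integral_mult_right_zero inv ..
    also have "\<dots> = complex_of_real (2 * pi * (2 * (exp (c * y) * min (exp (- c * y)) (exp (d * y)))))"
      by (simp add: h_def exp_of_real[symmetric])
    also have "exp (c * y) * min (exp (- c * y)) (exp (d * y)) = min 1 (exp (y / 2))"
      unfolding min_mult_distrib_left by (simp add: exp_add[symmetric] d_def algebra_simps)
    finally show ?thesis .
  qed
  then show ?thesis using \<Phi>int by (simp add: mellin_rep_def \<Phi>_def[abs_def])
qed

section \<open>From the regularised start back to the bare distribution function\<close>

lemma nn_integral_exp_half_atMost:
  "(\<integral>\<^sup>+q. ennreal (exp (q / 2)) * indicator {..r} q \<partial>lborel) = ennreal (2 * exp (r / 2))"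
proof -
  have "(\<integral>\<^sup>+q. ennreal (exp (q / 2)) * indicator {..r} q \<partial>lborel)
      = (\<integral>\<^sup>+q. ennreal (exp (- (1/2 * q))) * indicator {- r..} q \<partial>lborel)"
    by (subst nn_integral_real_affine[where c="-1" and t=0])
      (auto intro!: nn_integral_cong split: split_indicator)
  also have "\<dots> = ennreal (0 - (- 2 * exp (- (1/2 * - r))))"
  proof (rule nn_integral_FTC_atLeast)
    have "LIM q at_top. - (1/2 * q) :> (at_bot :: real filter)"
      unfolding filterlim_uminus_at_bot minus_minus
      by (rule filterlim_tendsto_pos_mult_at_top[OF tendsto_const _ filterlim_ident]) simp
    then have "((\<lambda>q::real. exp (- (1/2 * q))) \<longlongrightarrow> 0) at_top"
      by (rule filterlim_compose[OF exp_at_bot])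
    from tendsto_mult_right_zero[OF this, of "- 2"]
    show "((\<lambda>q::real. - 2 * exp (- (1/2 * q))) \<longlongrightarrow> 0) at_top" by simp
  qed (auto intro!: derivative_eq_intros)
  finally show ?thesis by simp
qed

lemma nn_integral_gamma_weight_1_atLeast:
  "(\<integral>\<^sup>+p. ennreal (gamma_weight 1 p) * indicator {q..} p \<partial>lborel) = ennreal (exp (- exp q))"
proof -
  have "(\<integral>\<^sup>+p. ennreal (gamma_weight 1 p) * indicator {q..} p \<partial>lborel) = ennreal (0 - (- exp (- exp q)))"
  proof (rule nn_integral_FTC_atLeast)
    have "((\<lambda>p::real. exp (- exp p)) \<longlongrightarrow> 0) at_top"
      by (rule filterlim_compose[OF exp_at_bot]) (simp add: filterlim_uminus_at_bot exp_at_top)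
    from tendsto_minus[OF this] show "((\<lambda>p::real. - exp (- exp p)) \<longlongrightarrow> 0) at_top" by simp
    show "((\<lambda>p. - exp (- exp p)) has_real_derivative gamma_weight 1 p) (at p)" for p
      unfolding gamma_weight_def
      by (auto intro!: derivative_eq_intros simp: exp_add[symmetric] algebra_simps)
  qed auto
  then show ?thesis by simp
qed

text \<open>Integration by parts in the form of Tonelli. The left integrand is
  \<open>gamma_weight 1 p\<close> times the integral of \<open>exp (q / 2)\<close> over
  \<open>q \<le> min p y\<close>. Integrating over \<open>p \<ge> q\<close> first leaves
  \<open>exp (- exp q)\<close>, and \<open>exp (q / 2) * exp (- exp q)\<close> is
  \<open>gamma_weight (1/2) q\<close>.\<close>

lemma gamma_conv_min:
  "gamma_conv (3/2) (\<lambda>y. ennreal (2 * min 1 (exp (y / 2)))) y = gamma_conv (1/2) (indicator {0..}) y"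
proof -
  have "gamma_conv (3/2) (\<lambda>y. ennreal (2 * min 1 (exp (y / 2)))) y
      = (\<integral>\<^sup>+p. (\<integral>\<^sup>+q. ennreal (gamma_weight 1 p) * indicator {q..} p * (ennreal (exp (q / 2)) * indicator {..y} q) \<partial>lborel) \<partial>lborel)"
    unfolding gamma_conv_def
  proof (intro nn_integral_cong)
    fix p
    have "(\<integral>\<^sup>+q. ennreal (gamma_weight 1 p) * indicator {q..} p * (ennreal (exp (q / 2)) * indicator {..y} q) \<partial>lborel)
        = (\<integral>\<^sup>+q. ennreal (gamma_weight 1 p) * (ennreal (exp (q / 2)) * indicator {..min p y} q) \<partial>lborel)"
      by (intro nn_integral_cong) (auto split: split_indicator)
    also have "\<dots> = ennreal (gamma_weight 1 p) * ennreal (2 * exp (min p y / 2))"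
      by (subst nn_integral_cmult) (auto simp: nn_integral_exp_half_atMost)
    also have "\<dots> = ennreal (gamma_weight 1 p * (2 * exp (min p y / 2)))"
      by (simp add: ennreal_mult)
    also have "gamma_weight 1 p * (2 * exp (min p y / 2)) = gamma_weight (3/2) p * (2 * min 1 (exp ((y - p) / 2)))"
    proof (cases "p \<le> y")
      case True
      then have "min 1 (exp ((y - p) / 2)) = 1" "min p y = p" by auto
      then show ?thesis by (simp add: gamma_weight_def exp_add[symmetric])
    next
      case False
      then have "min 1 (exp ((y - p) / 2)) = exp ((y - p) / 2)" "min p y = y" by auto
      then show ?thesis by (simp add: gamma_weight_def exp_add[symmetric] diff_divide_distrib)
    qed
    finally show "ennreal (gamma_weight (3/2) p) * ennreal (2 * min 1 (exp ((y - p) / 2)))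
        = (\<integral>\<^sup>+q. ennreal (gamma_weight 1 p) * indicator {q..} p * (ennreal (exp (q / 2)) * indicator {..y} q) \<partial>lborel)"
      by (simp add: ennreal_mult)
  qed
  also have "\<dots> = (\<integral>\<^sup>+q. (\<integral>\<^sup>+p. ennreal (gamma_weight 1 p) * indicator {q..} p * (ennreal (exp (q / 2)) * indicator {..y} q) \<partial>lborel) \<partial>lborel)"
  proof (rule lborel_pair.Fubini')
    \<comment> \<open>The set \<open>{q..}\<close> moves with a variable of integration; written as
      a comparison, its indicator is seen to be jointly measurable.\<close>
    have *: "indicator {q..} p = (if q \<le> p then 1 else 0 :: ennreal)"
      "indicator {..y} q = (if q \<le> y then 1 else 0 :: ennreal)" for p q :: real
      by auto
    show "(\<lambda>(q, p). ennreal (gamma_weight 1 p) * indicator {q..} p * (ennreal (exp (q / 2)) * indicator {..y} q))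
        \<in> borel_measurable (lborel \<Otimes>\<^sub>M lborel)"
      unfolding * by measurable
  qed
  also have "\<dots> = gamma_conv (1/2) (indicator {0..}) y"
    unfolding gamma_conv_def
  proof (intro nn_integral_cong)
    fix q
    have "(\<integral>\<^sup>+p. ennreal (gamma_weight 1 p) * indicator {q..} p * (ennreal (exp (q / 2)) * indicator {..y} q) \<partial>lborel)
       = ennreal (exp (- exp q)) * (ennreal (exp (q / 2)) * indicator {..y} q)"
      by (subst nn_integral_multc) (auto simp: nn_integral_gamma_weight_1_atLeast)
    also have "\<dots> = ennreal (gamma_weight (1/2) q) * indicator {0..} (y - q)"
      by (auto simp: gamma_weight_def ennreal_mult[symmetric] exp_add[symmetric] split: split_indicator)
    finally show "(\<integral>\<^sup>+p. ennreal (gamma_weight 1 p) * indicator {q..} p * (ennreal (exp (q / 2)) * indicator {..y} q) \<partial>lborel)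
       = ennreal (gamma_weight (1/2) q) * indicator {0..} (y - q)" .
  qed
  finally show ?thesis .
qed

text \<open>\<open>Gamma (3/2 - s) = (1/2 - s) * Gamma (1/2 - s)\<close> cancels the regularising
  factor. The function represented is the lower incomplete gamma function of order 1/2 at
  \<open>exp y\<close>.\<close>

lemma mellin_rep_incomplete_gamma:
  assumes c: "0 < c" "c < 1/2"
  obtains f where "mellin_rep c (\<lambda>t. Gamma (1/2 - Complex c t) / Complex c t) f"
    and "\<And>y. gamma_conv (1/2) (indicator {0..}) y = ennreal (f y)"
proof -
  have "c < 3/2" using c by simp
  from mellin_rep_gamma_conv[OF mellin_rep_min[OF c] this]
  obtain f where f: "mellin_rep c (\<lambda>t. 1 / (Complex c t * (1/2 - Complex c t)) * Gamma (complex_of_real (3/2) - Complex c t)) f"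
    and conv: "gamma_conv (3/2) (\<lambda>y. ennreal (2 * min 1 (exp (y / 2)))) y = ennreal (f y)" for y
    by blast
  have "1 / (Complex c t * (1/2 - Complex c t)) * Gamma (complex_of_real (3/2) - Complex c t)
      = Gamma (1/2 - Complex c t) / Complex c t" for t
  proof -
    have re: "Re (1/2 - Complex c t) > 0" using c by simp
    then have "1/2 - Complex c t \<noteq> 0" by (metis zero_complex.sel(1) less_irrefl)
    moreover have "1/2 - Complex c t \<notin> \<int>\<^sub>\<le>\<^sub>0"
      using re by (auto elim!: nonpos_Ints_cases dest: arg_cong[of _ _ Re])
    then have "Gamma (1/2 - Complex c t + 1) = (1/2 - Complex c t) * Gamma (1/2 - Complex c t)"
      by (rule Gamma_plus1)
    moreover have "1/2 - Complex c t + 1 = complex_of_real (3/2) - Complex c t"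
      by (simp add: complex_eq_iff)
    ultimately show ?thesis by simp
  qed
  with f conv show ?thesis by (intro that[of f]) (simp_all add: gamma_conv_min)
qed

text \<open>The nesting follows the law of the product: integration over the density of
  \<open>Y\<close>, the inner one, contributes the shapes 1/2 and \<open>n + 1/2\<close>; that over
  the density of \<open>X\<close> contributes 1/2 and \<open>m + 1/2\<close>.\<close>

lemma mellin_rep_four_gammas:
  assumes c: "0 < c" "c < 1/2" "c < m + 1/2" "c < n + 1/2"
  obtains f where "mellin_rep c (\<lambda>t. Gamma (1/2 - Complex c t) / Complex c t * Gamma (complex_of_real (n + 1/2) - Complex c t)
      * Gamma (1/2 - Complex c t) * Gamma (complex_of_real (m + 1/2) - Complex c t)) f"
    and "\<And>y. gamma_conv (m + 1/2) (gamma_conv (1/2) (gamma_conv (n + 1/2) (gamma_conv (1/2) (indicator {0..})))) y = ennreal (f y)"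
proof -
  obtain f1 where f1: "mellin_rep c (\<lambda>t. Gamma (1/2 - Complex c t) / Complex c t) f1"
    and c1: "gamma_conv (1/2) (indicator {0..}) y = ennreal (f1 y)" for y
    using mellin_rep_incomplete_gamma[OF c(1,2)] by blast
  obtain f2 where f2: "mellin_rep c (\<lambda>t. Gamma (1/2 - Complex c t) / Complex c t * Gamma (complex_of_real (n + 1/2) - Complex c t)) f2"
    and c2: "gamma_conv (n + 1/2) (\<lambda>y. ennreal (f1 y)) y = ennreal (f2 y)" for y
    using mellin_rep_gamma_conv[OF f1 c(4)] by blast
  obtain f3 where f3: "mellin_rep c (\<lambda>t. Gamma (1/2 - Complex c t) / Complex c t * Gamma (complex_of_real (n + 1/2) - Complex c t)
      * Gamma (complex_of_real (1/2) - Complex c t)) f3"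
    and c3: "gamma_conv (1/2) (\<lambda>y. ennreal (f2 y)) y = ennreal (f3 y)" for y
    using mellin_rep_gamma_conv[OF f2 c(2)] by blast
  obtain f4 where f4: "mellin_rep c (\<lambda>t. Gamma (1/2 - Complex c t) / Complex c t * Gamma (complex_of_real (n + 1/2) - Complex c t)
      * Gamma (complex_of_real (1/2) - Complex c t) * Gamma (complex_of_real (m + 1/2) - Complex c t)) f4"
    and c4: "gamma_conv (m + 1/2) (\<lambda>y. ennreal (f3 y)) y = ennreal (f4 y)" for y
    using mellin_rep_gamma_conv[OF f3 c(3)] by blast
  have "complex_of_real (1/2) = 1/2" by simp
  with f4 have "mellin_rep c (\<lambda>t. Gamma (1/2 - Complex c t) / Complex c t * Gamma (complex_of_real (n + 1/2) - Complex c t)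
      * Gamma (1/2 - Complex c t) * Gamma (complex_of_real (m + 1/2) - Complex c t)) f4" by (simp only:)
  then show ?thesis by (rule that) (simp add: c1[abs_def] c2[abs_def] c3[abs_def] c4)
qed

section \<open>Variance-gamma densities\<close>

lemma borel_measurable_cosh [measurable]: "(cosh :: real \<Rightarrow> real) \<in> borel_measurable borel"
  by (intro borel_measurable_continuous_onI continuous_intros)

lemma nn_integral_even:
  fixes h :: "real \<Rightarrow> ennreal"
  assumes [measurable]: "h \<in> borel_measurable borel" and even: "\<And>x. h (- x) = h x"
  shows "(\<integral>\<^sup>+x. h x \<partial>lborel) = 2 * (\<integral>\<^sup>+x. h x * indicator {0<..} x \<partial>lborel)"
proof -
  have "(\<integral>\<^sup>+x. h x \<partial>lborel) = (\<integral>\<^sup>+x. h x * indicator {0<..} x + h x * indicator {..<0} x \<partial>lborel)"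
    using AE_lborel_singleton[of 0]
    by (intro nn_integral_cong_AE, eventually_elim) (auto split: split_indicator)
  also have "\<dots> = (\<integral>\<^sup>+x. h x * indicator {0<..} x \<partial>lborel) + (\<integral>\<^sup>+x. h x * indicator {..<0} x \<partial>lborel)"
    by (rule nn_integral_add) auto
  also have "(\<integral>\<^sup>+x. h x * indicator {..<0} x \<partial>lborel) = (\<integral>\<^sup>+x. h x * indicator {0<..} x \<partial>lborel)"
    by (subst nn_integral_real_affine[where c="-1" and t=0])
      (auto simp: even intro!: nn_integral_cong split: split_indicator)
  finally show ?thesis by (simp add: mult_2)
qed

text \<open>Finiteness excludes the default value 0 of a divergent Bochner integral; the two half
  lines differ by a null set.\<close>

lemma ennreal_besselK:
  assumes fin: "(\<integral>\<^sup>+t. ennreal (exp (- x * cosh t) * cosh (\<nu> * t)) * indicator {0<..} t \<partial>lborel) < \<infinity>"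
  shows "ennreal (besselK \<nu> x) = (\<integral>\<^sup>+t. ennreal (exp (- x * cosh t) * cosh (\<nu> * t)) * indicator {0<..} t \<partial>lborel)"
proof -
  define k where "k t = exp (- x * cosh t) * cosh (\<nu> * t)" for t
  have k0: "k t \<ge> 0" for t unfolding k_def by (simp add: cosh_real_nonneg)
  have [measurable]: "k \<in> borel_measurable borel" unfolding k_def by measurable
  have eq: "(\<integral>\<^sup>+t. ennreal (indicator {0..} t *\<^sub>R k t) \<partial>lborel) = (\<integral>\<^sup>+t. ennreal (k t) * indicator {0<..} t \<partial>lborel)"
    using AE_lborel_singleton[of 0]
    by (intro nn_integral_cong_AE, eventually_elim) (auto split: split_indicator)
  have int: "integrable lborel (\<lambda>t. indicator {0..} t *\<^sub>R k t)"
    by (rule integrableI_nonneg) (use fin eq k0 in \<open>auto simp: k_def\<close>)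
  have "ennreal (besselK \<nu> x) = (\<integral>\<^sup>+t. ennreal (indicator {0..} t *\<^sub>R k t) \<partial>lborel)"
    unfolding besselK_def set_lebesgue_integral_def k_def[symmetric]
    by (rule nn_integral_eq_integral[symmetric, OF int]) (simp add: k0)
  with eq show ?thesis by (simp add: k_def)
qed

lemma besselK_nonneg: "besselK \<nu> x \<ge> 0"
  unfolding besselK_def set_lebesgue_integral_def
  by (intro Bochner_Integration.integral_nonneg) (simp add: cosh_real_nonneg)

lemma besselK_measurable [measurable]: "besselK \<nu> \<in> borel_measurable borel"
  unfolding besselK_def set_lebesgue_integral_def by measurable

lemma vg_pdf_measurable [measurable]: "vg_pdf \<mu> \<alpha> \<beta> \<in> borel_measurable borel"
  unfolding vg_pdf_def by measurable

lemma vg_pdf_even: "vg_pdf \<mu> \<alpha> 0 (- x) = vg_pdf \<mu> \<alpha> 0 x"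
  by (simp add: vg_pdf_def)

text \<open>Averaging with the reflection of \<open>t\<close> replaces
  \<open>exp (\<mu> * t)\<close> by \<open>cosh (\<mu> * t)\<close>. The full-line form arises from
  two gamma convolutions, the half-line form from \<open>besselK\<close>.\<close>

lemma nn_integral_exp_cosh:
  "(\<integral>\<^sup>+t. ennreal (exp (\<mu> * t - x * cosh t)) \<partial>lborel)
    = 2 * (\<integral>\<^sup>+t. ennreal (exp (- x * cosh t) * cosh (\<mu> * t)) * indicator {0<..} t \<partial>lborel)"
    (is "?B = 2 * ?N")
proof -
  have refl: "?B = (\<integral>\<^sup>+t. ennreal (exp (- \<mu> * t - x * cosh t)) \<partial>lborel)"
    by (subst nn_integral_real_affine[where c="-1" and t=0]) auto
  have "2 * ?B = ?B + (\<integral>\<^sup>+t. ennreal (exp (- \<mu> * t - x * cosh t)) \<partial>lborel)"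
    unfolding refl[symmetric] by (simp add: mult_2)
  also have "\<dots> = (\<integral>\<^sup>+t. ennreal (exp (\<mu> * t - x * cosh t)) + ennreal (exp (- \<mu> * t - x * cosh t)) \<partial>lborel)"
    by (rule nn_integral_add[symmetric]) auto
  also have "\<dots> = (\<integral>\<^sup>+t. 2 * ennreal (exp (- x * cosh t) * cosh (\<mu> * t)) \<partial>lborel)"
  proof (intro nn_integral_cong)
    fix t
    have "exp (\<mu> * t - x * cosh t) + exp (- \<mu> * t - x * cosh t) = 2 * (exp (- x * cosh t) * cosh (\<mu> * t))"
      unfolding cosh_field_def[of "\<mu> * t"] by (simp add: exp_diff exp_minus field_simps)
    then show "ennreal (exp (\<mu> * t - x * cosh t)) + ennreal (exp (- \<mu> * t - x * cosh t))
        = 2 * ennreal (exp (- x * cosh t) * cosh (\<mu> * t))"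
      by (simp add: ennreal_plus[symmetric] ennreal_mult' del: ennreal_plus)
  qed
  also have "\<dots> = 2 * (\<integral>\<^sup>+t. ennreal (exp (- x * cosh t) * cosh (\<mu> * t)) \<partial>lborel)"
    by (rule nn_integral_cmult) measurable
  also have "(\<integral>\<^sup>+t. ennreal (exp (- x * cosh t) * cosh (\<mu> * t)) \<partial>lborel) = 2 * ?N"
    by (rule nn_integral_even) auto
  finally have "2 * ?B = 2 * (2 * ?N)" .
  then show ?thesis by (subst (asm) ennreal_mult_cancel_left) simp
qed

text \<open>The substitution \<open>p = \<rho> + t\<close>, \<open>q = \<rho> - t\<close> with \<open>exp \<rho> = \<alpha> r / 2\<close>.\<close>
lemma gamma_conv_gamma_conv:
  assumes [measurable]: "g \<in> borel_measurable borel" and \<alpha>: "\<alpha> > 0"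
  shows "gamma_conv (\<mu> + 1/2) (gamma_conv (1/2) g) y
    = ennreal \<alpha> * (\<integral>\<^sup>+r. ennreal ((\<alpha> * r / 2) powr \<mu>) * (\<integral>\<^sup>+t. ennreal (exp (\<mu> * t - (\<alpha> * r) * cosh t)) \<partial>lborel)
         * g (y - 2 * ln (\<alpha> * r / 2)) * indicator {0<..} r \<partial>lborel)"
proof -
  define B where "B x = (\<integral>\<^sup>+t. ennreal (exp (\<mu> * t - x * cosh t)) \<partial>lborel)" for x
  have [measurable]: "B \<in> borel_measurable borel" unfolding B_def by measurable
  define h where "h x = ennreal (x powr \<mu>) * B (2 * x) * g (y - 2 * ln x)" for x
  have [measurable]: "h \<in> borel_measurable borel" unfolding h_def by measurable
  have "gamma_conv (\<mu> + 1/2) (gamma_conv (1/2) g) y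
      = (\<integral>\<^sup>+p. ennreal (gamma_weight (\<mu> + 1/2) p) * (\<integral>\<^sup>+q. ennreal (gamma_weight (1/2) q) * g (y - p - q) \<partial>lborel) \<partial>lborel)"
    by (simp add: gamma_conv_def)
  \<comment> \<open>The change of variables is made in two affine steps:
    \<open>q = 2 * \<rho> - p\<close> for fixed \<open>p\<close>, with Jacobian 2, and after Tonelli
    \<open>p = \<rho> + t\<close> for fixed \<open>\<rho>\<close>.\<close>
  also have "\<dots> = (\<integral>\<^sup>+p. (\<integral>\<^sup>+\<rho>. 2 * (ennreal (gamma_weight (\<mu> + 1/2) p) * ennreal (gamma_weight (1/2) (2 * \<rho> - p)) * g (y - 2 * \<rho>)) \<partial>lborel) \<partial>lborel)"
  proof (intro nn_integral_cong)
    fix p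
    show "ennreal (gamma_weight (\<mu> + 1/2) p) * (\<integral>\<^sup>+q. ennreal (gamma_weight (1/2) q) * g (y - p - q) \<partial>lborel)
      = (\<integral>\<^sup>+\<rho>. 2 * (ennreal (gamma_weight (\<mu> + 1/2) p) * ennreal (gamma_weight (1/2) (2 * \<rho> - p)) * g (y - 2 * \<rho>)) \<partial>lborel)"
      by (subst nn_integral_real_affine[where c=2 and t="- p"])
         (auto simp: nn_integral_cmult[symmetric] mult_ac intro!: nn_integral_cong)
  qed
  also have "\<dots> = (\<integral>\<^sup>+\<rho>. (\<integral>\<^sup>+p. 2 * (ennreal (gamma_weight (\<mu> + 1/2) p) * ennreal (gamma_weight (1/2) (2 * \<rho> - p)) * g (y - 2 * \<rho>)) \<partial>lborel) \<partial>lborel)"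
    by (rule lborel_pair.Fubini') measurable
  also have "\<dots> = (\<integral>\<^sup>+\<rho>. 2 * (h (exp \<rho>) * ennreal (exp \<rho>)) \<partial>lborel)"
  proof (intro nn_integral_cong)
    fix \<rho>
    have "(\<integral>\<^sup>+p. 2 * (ennreal (gamma_weight (\<mu> + 1/2) p) * ennreal (gamma_weight (1/2) (2 * \<rho> - p)) * g (y - 2 * \<rho>)) \<partial>lborel)
        = (\<integral>\<^sup>+t. 2 * (ennreal (gamma_weight (\<mu> + 1/2) (\<rho> + t)) * ennreal (gamma_weight (1/2) (\<rho> - t)) * g (y - 2 * \<rho>)) \<partial>lborel)"
      by (subst nn_integral_real_affine[where c=1 and t=\<rho>]) (auto intro!: nn_integral_cong simp: algebra_simps)
    also have "\<dots> = (\<integral>\<^sup>+t. (2 * ennreal (exp ((\<mu> + 1) * \<rho>)) * g (y - 2 * \<rho>)) * ennreal (exp (\<mu> * t - (2 * exp \<rho>) * cosh t)) \<partial>lborel)"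
    proof (intro nn_integral_cong)
      fix t
      \<comment> \<open>The linear exponents add up to
        \<open>(\<mu> + 1) * \<rho> + \<mu> * t\<close>, and \<open>exp (\<rho> + t) + exp (\<rho> -
        t) = 2 * exp \<rho> * cosh t\<close>.\<close>
      have "gamma_weight (\<mu> + 1/2) (\<rho> + t) * gamma_weight (1/2) (\<rho> - t)
          = exp ((\<mu> + 1) * \<rho>) * exp (\<mu> * t - (2 * exp \<rho>) * cosh t)"
        unfolding gamma_weight_def exp_add[symmetric] cosh_field_def
        by (simp add: exp_add exp_diff exp_minus field_simps)
      then have "ennreal (gamma_weight (\<mu> + 1/2) (\<rho> + t)) * ennreal (gamma_weight (1/2) (\<rho> - t))
          = ennreal (exp ((\<mu> + 1) * \<rho>)) * ennreal (exp (\<mu> * t - (2 * exp \<rho>) * cosh t))"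
        by (simp add: ennreal_mult[symmetric])
      then show "2 * (ennreal (gamma_weight (\<mu> + 1/2) (\<rho> + t)) * ennreal (gamma_weight (1/2) (\<rho> - t)) * g (y - 2 * \<rho>))
          = (2 * ennreal (exp ((\<mu> + 1) * \<rho>)) * g (y - 2 * \<rho>)) * ennreal (exp (\<mu> * t - (2 * exp \<rho>) * cosh t))"
        by (simp only: mult_ac)
    qed
    also have "\<dots> = (2 * ennreal (exp ((\<mu> + 1) * \<rho>)) * g (y - 2 * \<rho>)) * B (2 * exp \<rho>)"
      unfolding B_def by (rule nn_integral_cmult) measurable
    \<comment> \<open>One factor \<open>exp \<rho>\<close> is split off as the Jacobian of
      \<open>x = exp \<rho>\<close>.\<close>
    also have "ennreal (exp ((\<mu> + 1) * \<rho>)) = ennreal (exp \<rho> powr \<mu>) * ennreal (exp \<rho>)"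
      by (simp add: ennreal_mult[symmetric] powr_def exp_add[symmetric] distrib_right)
    finally show "(\<integral>\<^sup>+p. 2 * (ennreal (gamma_weight (\<mu> + 1/2) p) * ennreal (gamma_weight (1/2) (2 * \<rho> - p)) * g (y - 2 * \<rho>)) \<partial>lborel)
        = 2 * (h (exp \<rho>) * ennreal (exp \<rho>))"
      by (simp add: h_def mult_ac)
  qed
  also have "\<dots> = 2 * (\<integral>\<^sup>+\<rho>. h (exp \<rho>) * ennreal (exp \<rho>) \<partial>lborel)"
    by (rule nn_integral_cmult) measurable
  also have "(\<integral>\<^sup>+\<rho>. h (exp \<rho>) * ennreal (exp \<rho>) \<partial>lborel) = (\<integral>\<^sup>+x. h x * indicator {0<..} x \<partial>lborel)"
    by (rule nn_integral_exp_substitution[symmetric]) measurable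
  also have "\<dots> = ennreal \<bar>\<alpha> / 2\<bar> * (\<integral>\<^sup>+r. h (0 + \<alpha> / 2 * r) * indicator {0<..} (0 + \<alpha> / 2 * r) \<partial>lborel)"
    using \<alpha> by (intro nn_integral_real_affine) auto
  also have "(\<integral>\<^sup>+r. h (0 + \<alpha> / 2 * r) * indicator {0<..} (0 + \<alpha> / 2 * r) \<partial>lborel)
      = (\<integral>\<^sup>+r. ennreal ((\<alpha> * r / 2) powr \<mu>) * B (\<alpha> * r) * g (y - 2 * ln (\<alpha> * r / 2)) * indicator {0<..} r \<partial>lborel)"
    using \<alpha> by (intro nn_integral_cong) (auto simp: h_def zero_less_mult_iff split: split_indicator)
  also have "2 * (ennreal \<bar>\<alpha> / 2\<bar> * x) = ennreal \<alpha> * x" for x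
  proof -
    have "2 * ennreal \<bar>\<alpha> / 2\<bar> = ennreal (2 * \<bar>\<alpha> / 2\<bar>)" by (subst ennreal_mult) auto
    then show ?thesis using \<alpha> by (simp add: mult.assoc[symmetric])
  qed
  finally show ?thesis by (simp only: B_def)
qed

lemma gamma_conv_const_one:
  assumes "a > 0"
  shows "gamma_conv a (\<lambda>_. 1) y = ennreal (LBINT p. gamma_weight a p)"
  unfolding gamma_conv_def
  by (simp add: nn_integral_eq_integral integrable_gamma_weight assms)

text \<open>The Bochner integral defining \<^const>\<open>besselK\<close> is zero if it diverges. Its convergence almost
  everywhere is read off from the finiteness of the gamma integrals.\<close>
lemma AE_nn_integral_besselK_finite:
  assumes \<mu>: "\<mu> > - 1/2" and \<alpha>: "\<alpha> > 0"
  shows "AE r in lborel. r > 0 \<longrightarrow> (\<integral>\<^sup>+t. ennreal (exp (\<mu> * t - (\<alpha> * r) * cosh t)) \<partial>lborel) < \<infinity>"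
proof -
  define B where "B x = (\<integral>\<^sup>+t. ennreal (exp (\<mu> * t - x * cosh t)) \<partial>lborel)" for x
  have [measurable]: "B \<in> borel_measurable borel" unfolding B_def by measurable
  define I where "I = (\<integral>\<^sup>+r. ennreal ((\<alpha> * r / 2) powr \<mu>) * B (\<alpha> * r) * 1 * indicator {0<..} r \<partial>lborel)"
  \<comment> \<open>For the constant function 1 the double convolution is a product of two complete
    gamma integrals, finite because \<open>\<mu> + 1/2 > 0\<close>.\<close>
  have "ennreal \<alpha> * I = gamma_conv (\<mu> + 1/2) (gamma_conv (1/2) (\<lambda>_. 1)) 0"
    unfolding I_def B_def by (rule gamma_conv_gamma_conv[symmetric, OF _ \<alpha>]) simp
  also have "gamma_conv (1/2) (\<lambda>_. 1) = (\<lambda>_. ennreal (LBINT p. gamma_weight (1/2) p))"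
    by (intro ext gamma_conv_const_one) simp
  also have "gamma_conv (\<mu> + 1/2) \<dots> 0 = gamma_conv (\<mu> + 1/2) (\<lambda>_. 1) 0 * ennreal (LBINT p. gamma_weight (1/2) p)"
    unfolding gamma_conv_def by (subst nn_integral_multc[symmetric]) auto
  also have "\<dots> < \<infinity>"
    using \<mu> by (subst gamma_conv_const_one) (auto simp: ennreal_mult_less_top)
  finally have "I \<noteq> \<infinity>" using \<alpha> by (auto simp: ennreal_mult_less_top)
  then have "AE r in lborel. ennreal ((\<alpha> * r / 2) powr \<mu>) * B (\<alpha> * r) * 1 * indicator {0<..} r \<noteq> \<infinity>"
    unfolding I_def by (intro nn_integral_noteq_infinite) measurable
  then show ?thesis
  proof eventually_elim
    case (elim r)
    show ?case
    proof
      assume "r > 0"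
      moreover from this have "ennreal ((\<alpha> * r / 2) powr \<mu>) \<noteq> 0" using \<alpha> by simp
      ultimately show "(\<integral>\<^sup>+t. ennreal (exp (\<mu> * t - (\<alpha> * r) * cosh t)) \<partial>lborel) < \<infinity>"
        using elim by (auto simp: B_def ennreal_mult_eq_top_iff less_top)
    qed
  qed
qed

text \<open>This says that \<open>(\<alpha> * X / 2)\<^sup>2\<close> is distributed as a product of
  independent gamma variables of shapes \<open>\<mu> + 1/2\<close> and 1/2. The constant normalises
  both, since \<open>Gamma (1/2) = sqrt pi\<close>.\<close>

lemma nn_integral_vg_pdf:
  assumes [measurable]: "g \<in> borel_measurable borel" and \<mu>: "\<mu> > - 1/2" and \<alpha>: "\<alpha> > 0"
  shows "(\<integral>\<^sup>+x. ennreal (vg_pdf \<mu> \<alpha> 0 x) * g (y - ln ((\<alpha> * x / 2)\<^sup>2)) \<partial>lborel)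
    = ennreal (1 / (sqrt pi * Gamma (\<mu> + 1/2))) * gamma_conv (\<mu> + 1/2) (gamma_conv (1/2) g) y"
proof -
  define C where "C = 1 / (sqrt pi * Gamma (\<mu> + 1/2))"
  have C: "C > 0" using \<mu> by (simp add: C_def Gamma_real_pos)
  define B where "B x = (\<integral>\<^sup>+t. ennreal (exp (\<mu> * t - x * cosh t)) \<partial>lborel)" for x
  have [measurable]: "B \<in> borel_measurable borel" unfolding B_def by measurable
  have "(\<integral>\<^sup>+x. ennreal (vg_pdf \<mu> \<alpha> 0 x) * g (y - ln ((\<alpha> * x / 2)\<^sup>2)) \<partial>lborel)
      = 2 * (\<integral>\<^sup>+x. ennreal (vg_pdf \<mu> \<alpha> 0 x) * g (y - ln ((\<alpha> * x / 2)\<^sup>2)) * indicator {0<..} x \<partial>lborel)"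
    by (rule nn_integral_even) (auto simp: vg_pdf_even)
  also have "\<dots> = (\<integral>\<^sup>+x. 2 * (ennreal (vg_pdf \<mu> \<alpha> 0 x) * g (y - ln ((\<alpha> * x / 2)\<^sup>2)) * indicator {0<..} x) \<partial>lborel)"
    by (rule nn_integral_cmult[symmetric]) measurable
  \<comment> \<open>The factor 2 from evenness of the density is absorbed by
    \<open>B = 2 * besselK\<close>, valid wherever the Bessel integral converges, hence almost
    everywhere.\<close>
  also have "\<dots> = (\<integral>\<^sup>+r. (ennreal C * ennreal \<alpha>) * (ennreal ((\<alpha> * r / 2) powr \<mu>) * B (\<alpha> * r)
         * g (y - 2 * ln (\<alpha> * r / 2)) * indicator {0<..} r) \<partial>lborel)"
    using AE_nn_integral_besselK_finite[OF \<mu> \<alpha>]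
  proof (intro nn_integral_cong_AE, eventually_elim)
    case (elim r)
    show ?case
    proof (cases "r > 0")
      case True
      have "2 * (\<integral>\<^sup>+t. ennreal (exp (- (\<alpha> * r) * cosh t) * cosh (\<mu> * t)) * indicator {0<..} t \<partial>lborel) < \<infinity>"
        using elim True unfolding nn_integral_exp_cosh by blast
      then have "ennreal (besselK \<mu> (\<alpha> * r)) = (\<integral>\<^sup>+t. ennreal (exp (- (\<alpha> * r) * cosh t) * cosh (\<mu> * t)) * indicator {0<..} t \<partial>lborel)"
        by (intro ennreal_besselK) (auto simp: ennreal_mult_less_top)
      then have B: "B (\<alpha> * r) = 2 * ennreal (besselK \<mu> (\<alpha> * r))"
        unfolding B_def nn_integral_exp_cosh by simp
      have "vg_pdf \<mu> \<alpha> 0 r = C * (\<alpha> powr (2 * \<mu> + 1) / (2 * \<alpha>) powr \<mu> * r powr \<mu>) * besselK \<mu> (\<alpha> * r)"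
      proof -
        have "(\<alpha>\<^sup>2) powr (\<mu> + 1/2) = \<alpha> powr (2 * \<mu> + 1)"
          using \<alpha> by (simp add: powr_powr distrib_left flip: powr_numeral)
        then show ?thesis using True \<alpha> by (simp add: vg_pdf_def C_def)
      qed
      also have "\<alpha> powr (2 * \<mu> + 1) / (2 * \<alpha>) powr \<mu> * r powr \<mu> = \<alpha> * (\<alpha> * r / 2) powr \<mu>"
      proof -
        have "\<alpha> powr (2 * \<mu> + 1) = \<alpha> powr \<mu> * \<alpha> powr \<mu> * \<alpha>"
          unfolding mult_2 powr_add using \<alpha> by simp
        then show ?thesis using True \<alpha> by (simp add: powr_mult powr_divide)
      qed
      finally have "ennreal (vg_pdf \<mu> \<alpha> 0 r) = ennreal C * ennreal \<alpha> * ennreal ((\<alpha> * r / 2) powr \<mu>) * ennreal (besselK \<mu> (\<alpha> * r))"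
        using C \<alpha> True besselK_nonneg[of \<mu> "\<alpha> * r"] by (simp add: ennreal_mult mult_ac)
      moreover have "ln ((\<alpha> * r / 2)\<^sup>2) = 2 * ln (\<alpha> * r / 2)"
        using True \<alpha> by (simp add: ln_realpow)
      ultimately show ?thesis by (simp only: B mult_ac)
    qed simp
  qed
  also have "\<dots> = (ennreal C * ennreal \<alpha>) * (\<integral>\<^sup>+r. ennreal ((\<alpha> * r / 2) powr \<mu>) * B (\<alpha> * r)
         * g (y - 2 * ln (\<alpha> * r / 2)) * indicator {0<..} r \<partial>lborel)"
    by (rule nn_integral_cmult) measurable
  also have "\<dots> = ennreal C * gamma_conv (\<mu> + 1/2) (gamma_conv (1/2) g) y"
    unfolding B_def by (subst gamma_conv_gamma_conv[OF _ \<alpha>]) (auto simp: mult_ac)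
  finally show ?thesis by (simp add: C_def)
qed

section \<open>The distribution of the product\<close>

text \<open>Without atoms, symmetry splits the mass outside
  \<open>{- \<bar>z\<bar>..\<bar>z\<bar>}\<close> evenly between the two tails. The case
  \<open>z < 0\<close> follows from \<open>- z\<close> by complement, and \<open>sgn 0 = 0\<close>
  covers the origin.\<close>

lemma symmetric_cdf:
  fixes D :: "real measure"
  assumes D: "real_distribution D"
    and sym: "\<And>z. measure D {..z} = measure D {- z..}"
    and atomless: "\<And>z. measure D {z} = 0"
  shows "measure D {..z} = 1/2 + sgn z / 2 * measure D {- \<bar>z\<bar>..\<bar>z\<bar>}"
proof -
  interpret real_distribution D by fact
  have compl: "measure D {z..} = 1 - measure D {..z}" for z
  proof -
    have "measure D ({..z} \<union> {z<..}) = measure D {..z} + measure D {z<..}"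
      by (rule finite_measure_Union) auto
    moreover have "measure D ({z} \<union> {z<..}) = measure D {z} + measure D {z<..}"
      by (rule finite_measure_Union) auto
    moreover have "{..z} \<union> {z<..} = space D" "{z} \<union> {z<..} = {z..}" by auto
    ultimately show ?thesis using atomless[of z] prob_space by simp
  qed
  have pos: "measure D {..z} = 1/2 + 1/2 * measure D {- z..z}" if "z \<ge> 0" for z
  proof -
    have "measure D ({..-z} \<union> {-z..z}) \<le> measure D {..-z} + measure D {-z..z}"
      by (rule measure_Un_le) auto
    moreover have "{..-z} \<union> {-z..z} = {..z}" using that by auto
    moreover have "measure D ({..<-z} \<union> {-z..z}) = measure D {..<-z} + measure D {-z..z}"
      by (rule finite_measure_Union) auto
    moreover have "{..<-z} \<union> {-z..z} = {..z}" using that by auto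
    moreover have "measure D ({..<-z} \<union> {-z}) = measure D {..<-z} + measure D {-z}"
      by (rule finite_measure_Union) auto
    moreover have "{..<-z} \<union> {-z} = {..-z}" by auto
    ultimately have "measure D {..z} = measure D {..-z} + measure D {-z..z}"
      using atomless[of "-z"] by simp
    moreover have "measure D {..-z} = 1 - measure D {..z}"
      using sym[of "-z"] compl[of z] by simp
    ultimately show ?thesis by simp
  qed
  consider "z > 0" | "z = 0" | "z < 0" by linarith
  then show ?thesis
  proof cases
    case 1
    then show ?thesis using pos[of z] by simp
  next
    case 2
    then show ?thesis using pos[of 0] atomless[of 0] by simp
  next
    case 3
    have "measure D {..z} = 1 - measure D {..-z}" using sym[of z] compl[of "-z"] by simp
    then show ?thesis using 3 pos[of "-z"] by simp
  qed
qed

lemma (in prob_space) emeasure_distr_mult_indep: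
  fixes X Y :: "'a \<Rightarrow> real"
  assumes X: "distributed M lborel X p" and Y: "distributed M lborel Y q"
    and indep: "indep_var borel X borel Y" and [measurable]: "A \<in> sets borel"
  shows "emeasure (distr M borel (\<lambda>\<omega>. X \<omega> * Y \<omega>)) A
    = (\<integral>\<^sup>+x. p x * (\<integral>\<^sup>+y. q y * indicator A (x * y) \<partial>lborel) \<partial>lborel)"
proof -
  have [measurable]: "X \<in> borel_measurable M" "Y \<in> borel_measurable M"
    using distributed_measurable[OF X] distributed_measurable[OF Y] by simp_all
  have [measurable]: "p \<in> borel_measurable borel" "q \<in> borel_measurable borel"
    using distributed_borel_measurable[OF X] distributed_borel_measurable[OF Y] by simp_all
  \<comment> \<open>The rule for joint densities refers to \<open>lborel\<close>; it has the same
    measurable sets as \<open>borel\<close>, so independence transfers.\<close>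
  have "indep_var lborel X lborel Y"
    using indep unfolding indep_var_distribution_eq
    by (simp cong: distr_cong measurable_cong_sets)
  then have joint: "distributed M (lborel \<Otimes>\<^sub>M lborel) (\<lambda>\<omega>. (X \<omega>, Y \<omega>)) (\<lambda>(x, y). p x * q y)"
    by (intro distributed_joint_indep X Y sigma_finite_lborel)
  have "emeasure (distr M borel (\<lambda>\<omega>. X \<omega> * Y \<omega>)) A = (\<integral>\<^sup>+\<omega>. indicator A (X \<omega> * Y \<omega>) \<partial>M)"
    by (subst nn_integral_indicator[symmetric], simp, subst nn_integral_distr) auto
  also have "\<dots> = (\<integral>\<^sup>+\<omega>. (\<lambda>(x, y). indicator A (x * y)) (X \<omega>, Y \<omega>) \<partial>M)" by simp
  also have "\<dots> = (\<integral>\<^sup>+z. (\<lambda>(x, y). p x * q y) z * (\<lambda>(x, y). indicator A (x * y)) z \<partial>(lborel \<Otimes>\<^sub>M lborel))"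
    by (rule distributed_nn_integral[symmetric, OF joint]) measurable
  also have "\<dots> = (\<integral>\<^sup>+x. (\<integral>\<^sup>+y. p x * q y * indicator A (x * y) \<partial>lborel) \<partial>lborel)"
    by (subst lborel.nn_integral_fst[symmetric]) auto
  also have "\<dots> = (\<integral>\<^sup>+x. p x * (\<integral>\<^sup>+y. q y * indicator A (x * y) \<partial>lborel) \<partial>lborel)"
    by (intro nn_integral_cong) (simp add: mult.assoc nn_integral_cmult)
  finally show ?thesis .
qed

section \<open>Contours and integrands of the two Meijer G-functions\<close>

lemma separating_line_exists:
  assumes "m > - 1/2" "n > - 1/2"
  shows "\<exists>c. meijerG_separates 4 1 [1/2] [0, 0, m, n, -1/2] c"
    and "\<exists>c. meijerG_separates 4 1 [1] [1/2, 1/2, m + 1/2, n + 1/2, 0] c"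
proof -
  \<comment> \<open>The admissible lines of the first function form the strip
    \<open>-1/2 < c < e\<close>, nonempty by the hypotheses; the second strip is its shift by 1/2.
    Midpoints serve as witnesses, and their existence gives the \<open>SOME\<close> in
    \<open>meijerG\<close> its separating property.\<close>
  define e where "e = min 0 (min m n)"
  have "meijerG_separates 4 1 [1/2] [0, 0, m, n, -1/2] ((e - 1/2) / 2)"
    using assms by (auto simp: meijerG_separates_def e_def less_Suc_eq numeral_eq_Suc min_def)
  then show "\<exists>c. meijerG_separates 4 1 [1/2] [0, 0, m, n, -1/2] c" by blast
  have "meijerG_separates 4 1 [1] [1/2, 1/2, m + 1/2, n + 1/2, 0] ((e + 1/2) / 2)"
    using assms by (auto simp: meijerG_separates_def e_def less_Suc_eq numeral_eq_Suc min_def)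
  then show "\<exists>c. meijerG_separates 4 1 [1] [1/2, 1/2, m + 1/2, n + 1/2, 0] c" by blast
qed

text \<open>The upper parameter 1 and the lower parameter 0 contribute exactly this quotient, which
  is the Mellin integrand of a bare distribution function.\<close>

lemma Gamma_ratio_plus1:
  assumes "Re s > 0"
  shows "Gamma s / Gamma (1 + s) = (1 / s :: complex)"
proof -
  have s: "s \<notin> \<int>\<^sub>\<le>\<^sub>0" using assms by (auto elim!: nonpos_Ints_cases)
  have "Gamma (1 + s) = s * Gamma s" using Gamma_plus1[OF s] by (simp only: add.commute)
  moreover have "Gamma s \<noteq> 0" using s by (simp add: Gamma_eq_zero_iff)
  ultimately show ?thesis by simp
qed

lemma meijerG_kernel_half:
  assumes "0 < Re s"
  shows "meijerG_kernel 4 1 [1] [1/2, 1/2, m + 1/2, n + 1/2, 0] s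
    = Gamma (1/2 - s) / s * Gamma (complex_of_real (n + 1/2) - s) * Gamma (1/2 - s) * Gamma (complex_of_real (m + 1/2) - s)"
proof -
  \<comment> \<open>Only the last lower parameter enters the denominator of the kernel; the product
    over upper parameters there is empty.\<close>
  have "{4..<5} = {4::nat}" by auto
  then have "meijerG_kernel 4 1 [1] [1/2, 1/2, m + 1/2, n + 1/2, 0] s
    = Gamma (1/2 - s) * Gamma (1/2 - s) * Gamma (complex_of_real (m + 1/2) - s) * Gamma (complex_of_real (n + 1/2) - s) * (Gamma s / Gamma (1 + s))"
    by (simp add: meijerG_kernel_def numeral_eq_Suc)
  then show ?thesis by (simp add: Gamma_ratio_plus1[OF assms])
qed

text \<open>The arguments \<open>b - s\<close> and \<open>1 - a + s\<close> do not change when every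
  parameter and \<open>s\<close> increase by 1/2.\<close>

lemma meijerG_kernel_shift:
  "meijerG_kernel 4 1 [1/2] [0, 0, m, n, -1/2] s
    = meijerG_kernel 4 1 [1] [1/2, 1/2, m + 1/2, n + 1/2, 0] (s + 1/2)"
proof -
  have "{4..<5} = {4::nat}" by auto
  then show ?thesis
    by (simp add: meijerG_kernel_def numeral_eq_Suc algebra_simps)
qed


text \<open>The abscissa \<open>c\<close> is left free because each G-function has its own line,
  chosen by \<open>SOME\<close>; the formula is applied once for each of them.\<close>

lemma cdf_vg_product:
  fixes M :: "'a measure" and X Y :: "'a \<Rightarrow> real"
  assumes M: "prob_space M" and m: "m > - 1/2" and n: "n > - 1/2" and \<alpha>: "\<alpha>\<^sub>1 > 0" "\<alpha>\<^sub>2 > 0"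
    and X: "distributed M lborel X (\<lambda>x. ennreal (vg_pdf m \<alpha>\<^sub>1 0 x))"
    and Y: "distributed M lborel Y (\<lambda>x. ennreal (vg_pdf n \<alpha>\<^sub>2 0 x))"
    and indep: "prob_space.indep_var M borel X borel Y"
    and c: "0 < c" "c < 1/2" "c < m + 1/2" "c < n + 1/2"
  shows "complex_of_real (measure M {\<omega> \<in> space M. X \<omega> * Y \<omega> \<le> z})
    = 1/2 + complex_of_real (sgn z / (2 * pi * Gamma (m + 1/2) * Gamma (n + 1/2)))
      * (complex_of_real (1 / (2 * pi)) *
         (LBINT t. meijerG_kernel 4 1 [1] [1/2, 1/2, m + 1/2, n + 1/2, 0] (Complex c t)
            * complex_of_real (\<alpha>\<^sub>1\<^sup>2 * \<alpha>\<^sub>2\<^sup>2 / 16 * z\<^sup>2) powr Complex c t))"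
proof -
  interpret prob_space M by fact
  have [measurable]: "X \<in> borel_measurable M" "Y \<in> borel_measurable M"
    using distributed_measurable[OF X] distributed_measurable[OF Y] by simp_all
  define D where "D = distr M borel (\<lambda>\<omega>. X \<omega> * Y \<omega>)"
  have D: "real_distribution D"
    unfolding D_def by (intro real_distribution_distr) simp
  interpret D: real_distribution D by fact
  note law = emeasure_distr_mult_indep[OF X Y indep, folded D_def]
  have "emeasure D {..w} = emeasure D {- w..}" for w
  proof -
    have "emeasure D {..w} = (\<integral>\<^sup>+x. ennreal (vg_pdf m \<alpha>\<^sub>1 0 x)
        * (\<integral>\<^sup>+y. ennreal (vg_pdf n \<alpha>\<^sub>2 0 y) * indicator {..w} (x * y) \<partial>lborel) \<partial>lborel)"
      by (rule law) simp
    also have "\<dots> = (\<integral>\<^sup>+x. ennreal (vg_pdf m \<alpha>\<^sub>1 0 x)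
        * (\<integral>\<^sup>+y. ennreal (vg_pdf n \<alpha>\<^sub>2 0 y) * indicator {..w} (- x * y) \<partial>lborel) \<partial>lborel)"
      \<comment> \<open>Reflecting \<open>x\<close> alone already reverses the sign of the product,
        and the density of \<open>X\<close> is even.\<close>
      by (subst nn_integral_real_affine[where c="-1" and t=0]) (auto simp: vg_pdf_even)
    also have "\<dots> = (\<integral>\<^sup>+x. ennreal (vg_pdf m \<alpha>\<^sub>1 0 x)
        * (\<integral>\<^sup>+y. ennreal (vg_pdf n \<alpha>\<^sub>2 0 y) * indicator {- w..} (x * y) \<partial>lborel) \<partial>lborel)"
      by (intro nn_integral_cong arg_cong2[where f="(*)"] refl) (auto split: split_indicator)
    also have "\<dots> = emeasure D {- w..}"
      by (rule law[symmetric]) simp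
    finally show ?thesis .
  qed
  then have sym: "measure D {..w} = measure D {- w..}" for w
    by (simp add: measure_def)
  have "emeasure D {w} = 0" for w
  proof -
    have "emeasure D {w} = (\<integral>\<^sup>+x. ennreal (vg_pdf m \<alpha>\<^sub>1 0 x)
        * (\<integral>\<^sup>+y. ennreal (vg_pdf n \<alpha>\<^sub>2 0 y) * indicator {w} (x * y) \<partial>lborel) \<partial>lborel)"
      by (rule law) simp
    also have "\<dots> = 0"
    proof (rule nn_integral_zero')
      show "AE x in lborel. ennreal (vg_pdf m \<alpha>\<^sub>1 0 x)
        * (\<integral>\<^sup>+y. ennreal (vg_pdf n \<alpha>\<^sub>2 0 y) * indicator {w} (x * y) \<partial>lborel) = 0"
        using AE_lborel_singleton[of 0]
      proof eventually_elim
        case (elim x)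
        \<comment> \<open>For fixed \<open>x \<noteq> 0\<close> the product equals \<open>w\<close>
          only at \<open>y = w / x\<close>, a null set.\<close>
        have "AE y in lborel. ennreal (vg_pdf n \<alpha>\<^sub>2 0 y) * indicator {w} (x * y) = 0"
          using AE_lborel_singleton[of "w / x"]
          by eventually_elim (use elim in \<open>auto split: split_indicator simp: field_simps\<close>)
        then show ?case by (simp add: nn_integral_zero')
      qed
    qed
    finally show ?thesis .
  qed
  then have atomless: "measure D {w} = 0" for w
    by (simp add: measure_def)
  have cdf: "measure M {\<omega> \<in> space M. X \<omega> * Y \<omega> \<le> z} = 1/2 + sgn z / 2 * measure D {- \<bar>z\<bar>..\<bar>z\<bar>}"
  proof -
    have "measure M {\<omega> \<in> space M. X \<omega> * Y \<omega> \<le> z} = measure D {..z}"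
      unfolding D_def by (subst measure_distr) (auto intro!: arg_cong[where f="measure M"])
    then show ?thesis using symmetric_cdf[OF D sym atomless] by simp
  qed
  show ?thesis
  \<comment> \<open>At the origin \<open>sgn\<close> removes the Mellin term whatever its integral
    is; logarithms are taken only for \<open>z \<noteq> 0\<close>.\<close>
  proof (cases "z = 0")
    case True
    then show ?thesis unfolding cdf by simp
  next
    case z: False
    \<comment> \<open>With this value, \<open>\<bar>x * y\<bar> \<le> \<bar>z\<bar>\<close> means
      that the product of \<open>(\<alpha>\<^sub>1 * x / 2)\<^sup>2\<close> and
      \<open>(\<alpha>\<^sub>2 * y / 2)\<^sup>2\<close> is at most \<open>x\<^sub>0\<close>. In
      logarithms this is the indicator of \<open>{0..}\<close> from which the convolutions
      start.\<close>
    define x\<^sub>0 where "x\<^sub>0 = \<alpha>\<^sub>1\<^sup>2 * \<alpha>\<^sub>2\<^sup>2 / 16 * z\<^sup>2"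
    have x\<^sub>0: "x\<^sub>0 > 0" using \<alpha> z by (simp add: x\<^sub>0_def)
    define K where "K a = 1 / (sqrt pi * Gamma (a + 1/2))" for a :: real
    have K: "K m \<ge> 0" "K n \<ge> 0" using m n by (simp_all add: K_def Gamma_real_pos less_imp_le)
    obtain f where f: "mellin_rep c (\<lambda>t. Gamma (1/2 - Complex c t) / Complex c t * Gamma (complex_of_real (n + 1/2) - Complex c t)
        * Gamma (1/2 - Complex c t) * Gamma (complex_of_real (m + 1/2) - Complex c t)) f"
      and conv: "gamma_conv (m + 1/2) (gamma_conv (1/2) (gamma_conv (n + 1/2) (gamma_conv (1/2) (indicator {0..})))) y = ennreal (f y)" for y
      using mellin_rep_four_gammas[OF c] by blast
    have f0: "f y \<ge> 0" for y using f by (simp add: mellin_rep_def)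
    have "emeasure D {- \<bar>z\<bar>..\<bar>z\<bar>} = (\<integral>\<^sup>+x. ennreal (vg_pdf m \<alpha>\<^sub>1 0 x)
        * (\<integral>\<^sup>+y. ennreal (vg_pdf n \<alpha>\<^sub>2 0 y) * indicator {- \<bar>z\<bar>..\<bar>z\<bar>} (x * y) \<partial>lborel) \<partial>lborel)"
      by (rule law) simp
    also have "\<dots> = (\<integral>\<^sup>+x. ennreal (K n) * (ennreal (vg_pdf m \<alpha>\<^sub>1 0 x)
        * gamma_conv (n + 1/2) (gamma_conv (1/2) (indicator {0..})) (ln x\<^sub>0 - ln ((\<alpha>\<^sub>1 * x / 2)\<^sup>2))) \<partial>lborel)"
      using AE_lborel_singleton[of 0]
    proof (intro nn_integral_cong_AE, eventually_elim)
      fix x :: real assume elim: "x \<noteq> 0"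
      have "(\<integral>\<^sup>+y. ennreal (vg_pdf n \<alpha>\<^sub>2 0 y) * indicator {- \<bar>z\<bar>..\<bar>z\<bar>} (x * y) \<partial>lborel)
          = (\<integral>\<^sup>+y. ennreal (vg_pdf n \<alpha>\<^sub>2 0 y) * indicator {0..} (ln x\<^sub>0 - ln ((\<alpha>\<^sub>1 * x / 2)\<^sup>2) - ln ((\<alpha>\<^sub>2 * y / 2)\<^sup>2)) \<partial>lborel)"
        using AE_lborel_singleton[of 0]
      proof (intro nn_integral_cong_AE, eventually_elim)
        fix y :: real assume y: "y \<noteq> 0"
        have pos: "(\<alpha>\<^sub>1 * x / 2)\<^sup>2 > 0" "(\<alpha>\<^sub>2 * y / 2)\<^sup>2 > 0" using elim y \<alpha> by simp_all
        have "0 \<le> ln x\<^sub>0 - ln ((\<alpha>\<^sub>1 * x / 2)\<^sup>2) - ln ((\<alpha>\<^sub>2 * y / 2)\<^sup>2)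
            \<longleftrightarrow> ln ((\<alpha>\<^sub>1 * x / 2)\<^sup>2 * (\<alpha>\<^sub>2 * y / 2)\<^sup>2) \<le> ln x\<^sub>0"
          using pos by (subst ln_mult_pos) auto
        also have "\<dots> \<longleftrightarrow> (\<alpha>\<^sub>1 * x / 2)\<^sup>2 * (\<alpha>\<^sub>2 * y / 2)\<^sup>2 \<le> x\<^sub>0"
          using pos x\<^sub>0 by (intro ln_le_cancel_iff mult_pos_pos)
        also have "(\<alpha>\<^sub>1 * x / 2)\<^sup>2 * (\<alpha>\<^sub>2 * y / 2)\<^sup>2 = (\<alpha>\<^sub>1\<^sup>2 * \<alpha>\<^sub>2\<^sup>2 / 16) * (x * y)\<^sup>2"
          by (simp add: power_mult_distrib power_divide)
        also have "\<dots> \<le> x\<^sub>0 \<longleftrightarrow> (x * y)\<^sup>2 \<le> z\<^sup>2"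
          unfolding x\<^sub>0_def using \<alpha> by (intro mult_le_cancel_left_pos) simp
        also have "\<dots> \<longleftrightarrow> x * y \<in> {- \<bar>z\<bar>..\<bar>z\<bar>}"
          by (auto simp: abs_le_square_iff[symmetric])
        finally show "ennreal (vg_pdf n \<alpha>\<^sub>2 0 y) * indicator {- \<bar>z\<bar>..\<bar>z\<bar>} (x * y)
            = ennreal (vg_pdf n \<alpha>\<^sub>2 0 y) * indicator {0..} (ln x\<^sub>0 - ln ((\<alpha>\<^sub>1 * x / 2)\<^sup>2) - ln ((\<alpha>\<^sub>2 * y / 2)\<^sup>2))"
          by (simp add: indicator_def)
      qed
      also have "\<dots> = ennreal (K n) * gamma_conv (n + 1/2) (gamma_conv (1/2) (indicator {0..})) (ln x\<^sub>0 - ln ((\<alpha>\<^sub>1 * x / 2)\<^sup>2))"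
        unfolding K_def by (rule nn_integral_vg_pdf[OF _ n \<alpha>(2)]) simp
      finally show "ennreal (vg_pdf m \<alpha>\<^sub>1 0 x)
          * (\<integral>\<^sup>+y. ennreal (vg_pdf n \<alpha>\<^sub>2 0 y) * indicator {- \<bar>z\<bar>..\<bar>z\<bar>} (x * y) \<partial>lborel)
        = ennreal (K n) * (ennreal (vg_pdf m \<alpha>\<^sub>1 0 x)
          * gamma_conv (n + 1/2) (gamma_conv (1/2) (indicator {0..})) (ln x\<^sub>0 - ln ((\<alpha>\<^sub>1 * x / 2)\<^sup>2)))"
        by (simp add: mult_ac)
    qed
    also have "\<dots> = ennreal (K n) * (\<integral>\<^sup>+x. ennreal (vg_pdf m \<alpha>\<^sub>1 0 x)
        * gamma_conv (n + 1/2) (gamma_conv (1/2) (indicator {0..})) (ln x\<^sub>0 - ln ((\<alpha>\<^sub>1 * x / 2)\<^sup>2)) \<partial>lborel)"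
      by (rule nn_integral_cmult) measurable
    also have "(\<integral>\<^sup>+x. ennreal (vg_pdf m \<alpha>\<^sub>1 0 x)
        * gamma_conv (n + 1/2) (gamma_conv (1/2) (indicator {0..})) (ln x\<^sub>0 - ln ((\<alpha>\<^sub>1 * x / 2)\<^sup>2)) \<partial>lborel)
        = ennreal (K m) * ennreal (f (ln x\<^sub>0))"
      unfolding K_def conv[symmetric] by (rule nn_integral_vg_pdf[OF _ m \<alpha>(1)]) simp
    also have "ennreal (K n) * (ennreal (K m) * ennreal (f (ln x\<^sub>0))) = ennreal (K n * (K m * f (ln x\<^sub>0)))"
      using K f0 by (simp add: ennreal_mult)
    finally have P: "measure D {- \<bar>z\<bar>..\<bar>z\<bar>} = K n * (K m * f (ln x\<^sub>0))"
      using K f0 by (simp add: measure_def)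
    have KK: "K n * K m = 1 / (pi * Gamma (m + 1/2) * Gamma (n + 1/2))"
      by (simp add: K_def)
    have "(LBINT t. meijerG_kernel 4 1 [1] [1/2, 1/2, m + 1/2, n + 1/2, 0] (Complex c t)
            * complex_of_real x\<^sub>0 powr Complex c t) = complex_of_real (2 * pi * f (ln x\<^sub>0))"
    proof -
      have x\<^sub>0_powr: "complex_of_real x\<^sub>0 powr Complex c t = exp (Complex c t * complex_of_real (ln x\<^sub>0))" for t
        using x\<^sub>0 by (simp add: powr_def Ln_of_real)
      have "Re (Complex c t) > 0" for t using c by simp
      from meijerG_kernel_half[OF this] show ?thesis
        using f by (simp only: x\<^sub>0_powr mellin_rep_def)
    qed
    \<comment> \<open>The factor 1/2 from \<open>symmetric_cdf\<close> combines with
      \<open>KK\<close> to the stated prefactor; the remaining \<open>2 * pi\<close> is that of the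
      Mellin integral.\<close>
    moreover have "measure M {\<omega> \<in> space M. X \<omega> * Y \<omega> \<le> z}
        = 1/2 + sgn z / (2 * pi * Gamma (m + 1/2) * Gamma (n + 1/2)) * (1 / (2 * pi) * (2 * pi * f (ln x\<^sub>0)))"
      unfolding cdf P mult.assoc[symmetric] mult.assoc[of _ "K n"] KK by simp
    ultimately show ?thesis
      unfolding x\<^sub>0_def[symmetric] by simp
  qed
qed

theorem mainTheorem3:
  fixes M :: "'a measure" and X Y :: "'a \<Rightarrow> real"
    and m n \<alpha>\<^sub>1 \<alpha>\<^sub>2 :: real
  assumes "prob_space M"
    and "m > -1/2" and "n > -1/2" and "\<alpha>\<^sub>1 > 0" and "\<alpha>\<^sub>2 > 0"
    and "distributed M lborel X (\<lambda>x. ennreal (vg_pdf m \<alpha>\<^sub>1 0 x))"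
    and "distributed M lborel Y (\<lambda>x. ennreal (vg_pdf n \<alpha>\<^sub>2 0 x))"
    and "prob_space.indep_var M borel X borel Y"
  shows "\<forall>z::real.
     complex_of_real (measure M {\<omega> \<in> space M. X \<omega> * Y \<omega> \<le> z})
       = 1/2 + complex_of_real (\<alpha>\<^sub>1 * \<alpha>\<^sub>2 * z / (8 * pi * Gamma (m + 1/2) * Gamma (n + 1/2)))
           * meijerG 4 1 [1/2] [0, 0, m, n, -1/2] (\<alpha>\<^sub>1\<^sup>2 * \<alpha>\<^sub>2\<^sup>2 / 16 * z\<^sup>2)
   \<and> 1/2 + complex_of_real (\<alpha>\<^sub>1 * \<alpha>\<^sub>2 * z / (8 * pi * Gamma (m + 1/2) * Gamma (n + 1/2)))
           * meijerG 4 1 [1/2] [0, 0, m, n, -1/2] (\<alpha>\<^sub>1\<^sup>2 * \<alpha>\<^sub>2\<^sup>2 / 16 * z\<^sup>2)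
       = 1/2 + complex_of_real (sgn z / (2 * pi * Gamma (m + 1/2) * Gamma (n + 1/2)))
           * meijerG 4 1 [1] [1/2, 1/2, m + 1/2, n + 1/2, 0] (\<alpha>\<^sub>1\<^sup>2 * \<alpha>\<^sub>2\<^sup>2 / 16 * z\<^sup>2)"
proof
  fix z :: real
  let ?x = "\<alpha>\<^sub>1\<^sup>2 * \<alpha>\<^sub>2\<^sup>2 / 16 * z\<^sup>2"
  let ?F = "complex_of_real (measure M {\<omega> \<in> space M. X \<omega> * Y \<omega> \<le> z})"
  let ?\<Gamma> = "Gamma (m + 1/2) * Gamma (n + 1/2)"
  let ?\<phi> = "meijerG_kernel 4 1 [1] [1/2, 1/2, m + 1/2, n + 1/2, 0]"
  define c\<^sub>1 where "c\<^sub>1 = (SOME c. meijerG_separates 4 1 [1/2] [0, 0, m, n, -1/2] c)"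
  define c\<^sub>2 where "c\<^sub>2 = (SOME c. meijerG_separates 4 1 [1] [1/2, 1/2, m + 1/2, n + 1/2, 0] c)"
  have sep: "meijerG_separates 4 1 [1/2] [0, 0, m, n, -1/2] c\<^sub>1"
    "meijerG_separates 4 1 [1] [1/2, 1/2, m + 1/2, n + 1/2, 0] c\<^sub>2"
    unfolding c\<^sub>1_def c\<^sub>2_def using separating_line_exists[OF assms(2,3)] by (auto intro: someI_ex)
  \<comment> \<open>The line of the first function, moved by 1/2, is admissible for the second
    integrand.\<close>
  have c\<^sub>1: "0 < c\<^sub>1 + 1/2" "c\<^sub>1 + 1/2 < 1/2" "c\<^sub>1 + 1/2 < m + 1/2" "c\<^sub>1 + 1/2 < n + 1/2"
    using sep(1) by (auto simp: meijerG_separates_def less_Suc_eq numeral_eq_Suc all_conj_distrib)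
  have c\<^sub>2: "0 < c\<^sub>2" "c\<^sub>2 < 1/2" "c\<^sub>2 < m + 1/2" "c\<^sub>2 < n + 1/2"
    using sep(2) by (auto simp: meijerG_separates_def less_Suc_eq numeral_eq_Suc all_conj_distrib)
  note cdf = cdf_vg_product[OF assms]
  have G\<^sub>2: "?F = 1/2 + complex_of_real (sgn z / (2 * pi * Gamma (m + 1/2) * Gamma (n + 1/2)))
      * meijerG 4 1 [1] [1/2, 1/2, m + 1/2, n + 1/2, 0] ?x"
    using cdf[OF c\<^sub>2, of z] by (simp only: meijerG_def Let_def c\<^sub>2_def[symmetric])
  \<comment> \<open>Replacing \<open>s\<close> by \<open>s + 1/2\<close> in the integrand releases
    the factor \<open>?x powr (1/2) = \<alpha>\<^sub>1 * \<alpha>\<^sub>2 * \<bar>z\<bar> /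
    4\<close>. Together with \<open>sgn z * \<bar>z\<bar> = z\<close> it turns the prefactor with
    \<open>2 * pi\<close> into the one with \<open>8 * pi\<close>, pointwise under the
    integral.\<close>
  have "complex_of_real (\<alpha>\<^sub>1 * \<alpha>\<^sub>2 * z / (8 * pi * Gamma (m + 1/2) * Gamma (n + 1/2)))
        * (LBINT t. meijerG_kernel 4 1 [1/2] [0, 0, m, n, -1/2] (Complex c\<^sub>1 t) * complex_of_real ?x powr Complex c\<^sub>1 t)
      = complex_of_real (sgn z / (2 * pi * Gamma (m + 1/2) * Gamma (n + 1/2)))
        * (LBINT t. ?\<phi> (Complex (c\<^sub>1 + 1/2) t) * complex_of_real ?x powr Complex (c\<^sub>1 + 1/2) t)"
    unfolding integral_mult_right_zero[symmetric]
  proof (intro Bochner_Integration.integral_cong refl)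
    fix t
    have Cx: "Complex (c\<^sub>1 + 1/2) t = Complex c\<^sub>1 t + complex_of_real (1/2)" by (simp add: complex_eq_iff)
    have "?x = (\<alpha>\<^sub>1 * \<alpha>\<^sub>2 * \<bar>z\<bar> / 4)\<^sup>2" by (simp add: power_mult_distrib power_divide)
    then have half: "?x powr (1/2) = \<alpha>\<^sub>1 * \<alpha>\<^sub>2 * \<bar>z\<bar> / 4"
      using assms(4,5) by (simp add: powr_half_sqrt)
    have "0 \<le> ?x" by simp
    have e1: "complex_of_real ?x powr Complex (c\<^sub>1 + 1/2) t
        = complex_of_real ?x powr Complex c\<^sub>1 t * complex_of_real (\<alpha>\<^sub>1 * \<alpha>\<^sub>2 * \<bar>z\<bar> / 4)"
      unfolding Cx powr_add powr_of_real[OF \<open>0 \<le> ?x\<close>] half ..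
    have e2: "?\<phi> (Complex (c\<^sub>1 + 1/2) t) = meijerG_kernel 4 1 [1/2] [0, 0, m, n, -1/2] (Complex c\<^sub>1 t)"
      unfolding Cx meijerG_kernel_shift by simp
    have e3: "sgn z / (2 * pi * Gamma (m + 1/2) * Gamma (n + 1/2)) * (\<alpha>\<^sub>1 * \<alpha>\<^sub>2 * \<bar>z\<bar> / 4)
        = \<alpha>\<^sub>1 * \<alpha>\<^sub>2 * z / (8 * pi * Gamma (m + 1/2) * Gamma (n + 1/2))"
      by (simp add: sgn_if)
    show "complex_of_real (\<alpha>\<^sub>1 * \<alpha>\<^sub>2 * z / (8 * pi * Gamma (m + 1/2) * Gamma (n + 1/2)))
        * (meijerG_kernel 4 1 [1/2] [0, 0, m, n, -1/2] (Complex c\<^sub>1 t) * complex_of_real ?x powr Complex c\<^sub>1 t)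
      = complex_of_real (sgn z / (2 * pi * Gamma (m + 1/2) * Gamma (n + 1/2)))
        * (?\<phi> (Complex (c\<^sub>1 + 1/2) t) * complex_of_real ?x powr Complex (c\<^sub>1 + 1/2) t)"
      unfolding e1 e2 e3[symmetric] unfolding of_real_mult by (simp only: mult_ac)
  qed
  then have "?F = 1/2 + complex_of_real (\<alpha>\<^sub>1 * \<alpha>\<^sub>2 * z / (8 * pi * Gamma (m + 1/2) * Gamma (n + 1/2)))
      * meijerG 4 1 [1/2] [0, 0, m, n, -1/2] ?x"
    using cdf[OF c\<^sub>1, of z] by (simp only: meijerG_def Let_def c\<^sub>1_def[symmetric] mult.left_commute)
  with G\<^sub>2 show "?F = 1/2 + complex_of_real (\<alpha>\<^sub>1 * \<alpha>\<^sub>2 * z / (8 * pi * Gamma (m + 1/2) * Gamma (n + 1/2)))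
           * meijerG 4 1 [1/2] [0, 0, m, n, -1/2] ?x
   \<and> 1/2 + complex_of_real (\<alpha>\<^sub>1 * \<alpha>\<^sub>2 * z / (8 * pi * Gamma (m + 1/2) * Gamma (n + 1/2)))
           * meijerG 4 1 [1/2] [0, 0, m, n, -1/2] ?x
       = 1/2 + complex_of_real (sgn z / (2 * pi * Gamma (m + 1/2) * Gamma (n + 1/2)))
           * meijerG 4 1 [1] [1/2, 1/2, m + 1/2, n + 1/2, 0] ?x"
    by simp
qed

end
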